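(* Let $G$ be a 2-connected outerplane graph containing exactly two triangles, and let $Q$ be a graph containing exactly two triangles such that $G=Q-e$ for some edge $e\in E(Q)$. Then $Q$ is 3-colorable.
   Context: An outerplane graph is a graph embedded in the plane without edge crossings such that all vertices lie on the boundary of the outer face. A triangle is a cycle of length 3. A graph is 3-colorable if it admits a map $V\to\{1,2,3\}$ giving adjacent vertices distinct colors. *)

theory Defs
  imports "HOL-Analysis.Analysis"
begin

type_synonym 'a graph = "'a set \<times> 'a set set"

abbreviation verts :: "'a graph \<Rightarrow> 'a set" where
  "verts G \<equiv> fst G"

abbreviation edges :: "'a graph \<Rightarrow> 'a set set" where
  "edges G \<equiv> snd G"

definition simple_graph :: "'a graph \<Rightarrow> bool" where
  "simple_graph G \<longleftrightarrow>
     finite (verts G) \<and> (\<forall>e\<in>edges G. e \<subseteq> verts G \<and> card e = 2)"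

definition delete_edge :: "'a graph \<Rightarrow> 'a set \<Rightarrow> 'a graph" where
  "delete_edge G e = (verts G, edges G - {e})"

definition delete_verts :: "'a graph \<Rightarrow> 'a set \<Rightarrow> 'a graph" where
  "delete_verts G X = (verts G - X, {e \<in> edges G. e \<inter> X = {}})"

definition connected_graph :: "'a graph \<Rightarrow> bool" where
  "connected_graph G \<longleftrightarrow> verts G \<noteq> {} \<and>
     (\<forall>u\<in>verts G. \<forall>v\<in>verts G. (u, v) \<in> {(x, y). {x, y} \<in> edges G}\<^sup>*)"

definition k_connected :: "nat \<Rightarrow> 'a graph \<Rightarrow> bool" where
  "k_connected k G \<longleftrightarrow> card (verts G) > k \<and>
     (\<forall>X\<subseteq>verts G. card X < k \<longrightarrow> connected_graph (delete_verts G X))"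

text \<open>Triangles are subgraphs, each represented by its set of three edges.\<close>

definition triangles :: "'a graph \<Rightarrow> 'a set set set" where
  "triangles G = {{{x, y}, {y, z}, {z, x}} | x y z.
     x \<noteq> y \<and> y \<noteq> z \<and> z \<noteq> x \<and>
     {x, y} \<in> edges G \<and> {y, z} \<in> edges G \<and> {z, x} \<in> edges G}"

definition colorable :: "nat \<Rightarrow> 'a graph \<Rightarrow> bool" where
  "colorable k G \<longleftrightarrow> (\<exists>c :: 'a \<Rightarrow> nat. c ` verts G \<subseteq> {1..k} \<and>
     (\<forall>u v. {u, v} \<in> edges G \<longrightarrow> c u \<noteq> c v))"

text \<open>A drawing in the plane \<open>\<complex>\<close> places the vertex \<open>v\<close> at \<open>p v\<close> and represents the
  edge \<open>e\<close> by the arc \<open>\<gamma> e\<close>, traversed in either direction.\<close>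

definition drawing :: "'a graph \<Rightarrow> ('a \<Rightarrow> complex) \<Rightarrow> ('a set \<Rightarrow> real \<Rightarrow> complex) \<Rightarrow> complex set"
  where "drawing G p \<gamma> = p ` verts G \<union> (\<Union>e\<in>edges G. path_image (\<gamma> e))"

definition plane_embedding ::
  "'a graph \<Rightarrow> ('a \<Rightarrow> complex) \<Rightarrow> ('a set \<Rightarrow> real \<Rightarrow> complex) \<Rightarrow> bool" where
  "plane_embedding G p \<gamma> \<longleftrightarrow> inj_on p (verts G) \<and>
     (\<forall>e\<in>edges G.
        arc (\<gamma> e) \<and> {pathstart (\<gamma> e), pathfinish (\<gamma> e)} = p ` e \<and>
        (path_image (\<gamma> e) - p ` e) \<inter> p ` verts G = {} \<and>
        (\<forall>f\<in>edges G. f \<noteq> e \<longrightarrow> (path_image (\<gamma> e) - p ` e) \<inter> path_image (\<gamma> f) = {}))"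

text \<open>The drawing of a finite graph is compact, so \<^const>\<open>outside\<close> of it is the unique
  unbounded component of its complement, that is, the outer face.\<close>

definition outerplane ::
  "'a graph \<Rightarrow> ('a \<Rightarrow> complex) \<Rightarrow> ('a set \<Rightarrow> real \<Rightarrow> complex) \<Rightarrow> bool" where
  "outerplane G p \<gamma> \<longleftrightarrow> plane_embedding G p \<gamma> \<and>
     (\<forall>v\<in>verts G. p v \<in> frontier (outside (drawing G p \<gamma>)))"

end

theory Submission
  imports Defs
begin

text \<open>In a 2-connected outerplane graph a longest cycle is Hamiltonian: an ear leaving it would
  give three internally disjoint paths, each with an inner vertex, between two vertices, and then
  one of these inner vertices would be enclosed by the other two paths. For the same reason every
  chord runs inside the Hamiltonian cycle, so no two chords cross. Hence \<open>G\<close> is a graph on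
  \<open>{0..<n}\<close> without crossing pairs \<open>i < j < k < l\<close>, a class closed under subgraphs, in which every
  graph has a vertex of degree at most 2 and is therefore 3-colourable.

  Write \<open>e = {u, v}\<close>. As \<open>e\<close> creates no triangle, \<open>u\<close> and \<open>v\<close> have no common neighbour. A noncrossing graph with
  \<open>n\<close> vertices, \<open>m\<close> edges and \<open>t\<close> triangles satisfies \<open>2m \<le> 3n - 4 + t\<close>. Removing vertices of
  degree at most 2 of \<open>Q\<close>, we reach a situation where \<open>Q\<close> has minimum degree 3, and then \<open>t \<le> 2\<close>
  forces \<open>Q\<close> to be cubic. An innermost chord \<open>ab\<close> of \<open>G\<close> now cuts off a single vertex of degree 2, say \<open>u\<close>,
  forming a triangle \<open>uab\<close>. A colouring of the rest extends to this triangle unless \<open>v\<close> and the third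
  neighbours of \<open>a\<close> and \<open>b\<close> all have the same colour. If these third neighbours differ, they can be
  joined by an edge without creating a crossing, and if they coincide, their common value has only one
  other neighbour and can be recoloured.\<close>

section \<open>Noncrossing graphs on a linear order\<close>

text \<open>Graphs are symmetric, irreflexive sets of pairs, so \<open>card R\<close> is twice the
  number of edges. By symmetry it suffices to forbid crossings between pairs written with the
  smaller end first.\<close>

definition noncrossing :: "('b::linorder \<times> 'b) set \<Rightarrow> bool" where
  "noncrossing R \<longleftrightarrow> (\<forall>i j k l. i < j \<longrightarrow> j < k \<longrightarrow> k < l \<longrightarrow> (i, k) \<in> R \<longrightarrow> (j, l) \<notin> R)"

definition ordered_triangles :: "('b::linorder \<times> 'b) set \<Rightarrow> ('b \<times> 'b \<times> 'b) set" where
  "ordered_triangles R =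
     {(i, j, k). i < j \<and> j < k \<and> (i, j) \<in> R \<and> (j, k) \<in> R \<and> (i, k) \<in> R}"

text \<open>Colours are given to the whole type, so a restricted graph needs no separate domain and
  a removed vertex still has a colour to refer to.\<close>

definition proper3 :: "('b \<times> 'b) set \<Rightarrow> ('b \<Rightarrow> nat) \<Rightarrow> bool" where
  "proper3 R c \<longleftrightarrow> range c \<subseteq> {1..3} \<and> (\<forall>(x, y)\<in>R. c x \<noteq> c y)"

lemma noncrossingD:
  "noncrossing R \<Longrightarrow> (i, k) \<in> R \<Longrightarrow> (j, l) \<in> R \<Longrightarrow> i < j \<Longrightarrow> j < k \<Longrightarrow> k < l \<Longrightarrow> False"
  by (auto simp: noncrossing_def)

lemma noncrossing_mono: "noncrossing R \<Longrightarrow> R' \<subseteq> R \<Longrightarrow> noncrossing R'"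
  unfolding noncrossing_def by blast

text \<open>An edge from strictly under \<open>(i, k)\<close> to strictly beyond it would interleave
  with it; escaping to the right or to the left uses the two orientations of
  \<open>(x, y)\<close>.\<close>

lemma noncrossing_chord_side:
  assumes "noncrossing R" "sym R" "(i, k) \<in> R" "(x, y) \<in> R" "i < x" "x < k"
  shows "i \<le> y \<and> y \<le> k"
  using assms noncrossingD[OF assms(1,3,4)] noncrossingD[OF assms(1) symD[OF assms(2,4)] assms(3)]
  by force

section \<open>Counting edges against triangles\<close>

lemma finite_ordered_triangles:
  assumes "finite R" shows "finite (ordered_triangles R)"
proof -
  have "ordered_triangles R \<subseteq> (\<lambda>(e, k). (fst e, snd e, k)) ` (R \<times> snd ` R)"
    by (force simp: ordered_triangles_def image_iff)
  then show ?thesis using assms finite_subset by blast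
qed

lemma card_sym_irrefl:
  fixes R :: "('b::linorder \<times> 'b) set"
  assumes "finite R" "sym R" "irrefl R"
  shows "card R = 2 * card {(i, j)\<in>R. i < j}"
proof -
  let ?H = "{(i, j)\<in>R. i < j}"
  have R: "R = ?H \<union> ?H\<inverse>"
    using assms(2,3) by (auto simp: irrefl_def dest: symD)
  moreover have "?H \<inter> ?H\<inverse> = {}" by auto
  moreover have "finite ?H" using assms(1) by (rule finite_subset[rotated]) auto
  ultimately have "card (?H \<union> ?H\<inverse>) = card ?H + card (?H\<inverse>)"
    by (intro card_Un_disjoint) simp_all
  then show ?thesis using R by simp
qed

text \<open>Apart from \<open>(Min S, Max S)\<close>, every pair joins consecutive elements, so it
  is determined by its first component, which is never \<open>Max S\<close>. This leaves at most
  \<open>card S - 1\<close> pairs besides the exceptional one.\<close>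

lemma card_consecutive_pairs:
  fixes S :: "'b::linorder set"
  assumes "finite S" "S \<noteq> {}" "H \<subseteq> {(i, k). i \<in> S \<and> k \<in> S \<and> i < k}"
    and cons: "\<And>i k j. (i, k) \<in> H \<Longrightarrow> j \<in> S \<Longrightarrow> i < j \<Longrightarrow> j < k \<Longrightarrow> i = Min S \<and> k = Max S"
  shows "card H \<le> card S"
proof -
  let ?H = "H - {(Min S, Max S)}"
  have "inj_on fst ?H"
  proof (rule inj_onI)
    fix e f assume "e \<in> ?H" "f \<in> ?H" "fst e = fst f"
    then obtain a b b' where ef: "e = (a, b)" "f = (a, b')" and *: "(a, b) \<in> H" "(a, b') \<in> H"
      "(a, b) \<noteq> (Min S, Max S)" "(a, b') \<noteq> (Min S, Max S)" by (cases e, cases f) auto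
    have "\<not> b < b'" using cons[of a b' b] * assms(3) by auto
    moreover have "\<not> b' < b" using cons[of a b b'] * assms(3) by auto
    ultimately show "e = f" using ef by auto
  qed
  moreover have "fst ` ?H \<subseteq> S - {Max S}"
    using assms(1,3) by (fastforce dest: Max_ge)
  ultimately have "card ?H \<le> card (S - {Max S})"
    using assms(1) card_inj_on_le by (metis finite_Diff)
  also have "\<dots> = card S - 1" using assms by simp
  finally have "card ?H \<le> card S - 1" .
  moreover have "finite H"
    using assms(1,3) by (intro finite_subset[of H "S \<times> S"]) auto
  then have "card H \<le> card ?H + 1"
    by (auto simp: card_Diff_singleton_if)
  moreover have "card S > 0" using assms by (simp add: card_gt_0_iff)
  ultimately show ?thesis by linarith
qed

text \<open>Since \<open>card R\<close> counts edges twice, this is the bound 2m \<le> 3n - 4 + t.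
  An edge with vertices both under it and beyond it splits the graph into two parts sharing its two
  ends and this edge but no triangle, and the two bounds add up exactly. Without such an edge only
  consecutive vertices, or the least and the greatest, are joined, so m \<le> n.\<close>

lemma noncrossing_card_le:
  fixes S :: "'b::linorder set"
  assumes "finite S" "card S \<ge> 2" "R \<subseteq> S \<times> S" "sym R" "irrefl R" "noncrossing R"
  shows "card R + 4 \<le> 3 * card S + card (ordered_triangles R)"
  using assms
proof (induction "card S" arbitrary: S R rule: less_induct)
  case less
  have finR: "finite R" using less.prems by (meson finite_SigmaI finite_subset)
  note symD = symD[OF less.prems(4)]
  show ?case
  proof (cases "\<exists>i k j l. (i, k) \<in> R \<and> i < k \<and> j \<in> S \<and> i < j \<and> j < k \<and> l \<in> S \<and> (l < i \<or> k < l)")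
    case True
    then obtain i k j l where ik: "(i, k) \<in> R" "i < k" and j: "j \<in> S" "i < j" "j < k"
      and l: "l \<in> S" "l < i \<or> k < l" by blast
    define S1 where "S1 = {x\<in>S. i \<le> x \<and> x \<le> k}"
    define S2 where "S2 = {x\<in>S. x \<le> i \<or> k \<le> x}"
    define R1 where "R1 = R \<inter> S1 \<times> S1"
    define R2 where "R2 = R \<inter> S2 \<times> S2"
    have ikS: "i \<in> S" "k \<in> S" using ik less.prems(3) by auto
    have S: "S1 \<union> S2 = S" "S1 \<inter> S2 = {i, k}" using ik ikS by (auto simp: S1_def S2_def)
    have fin: "finite S1" "finite S2" using less.prems(1) by (auto simp: S1_def S2_def)
    have cS: "card S1 + card S2 = card S + 2"
      using card_Un_Int[OF fin] S ik by simp
    have "S1 \<subseteq> S" "S2 \<subseteq> S" "l \<notin> S1" "j \<notin> S2" using j l by (auto simp: S1_def S2_def)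
    then have "S1 \<subset> S" "S2 \<subset> S" using j(1) l(1) by blast+
    then have lt: "card S1 < card S" "card S2 < card S"
      using less.prems(1) by (auto intro: psubset_card_mono)
    have ge: "card S1 \<ge> 2" "card S2 \<ge> 2" using cS lt by linarith+
    have R: "R = R1 \<union> R2"
    proof -
      have "x \<in> S1 \<and> y \<in> S1 \<or> x \<in> S2 \<and> y \<in> S2" if "(x, y) \<in> R" for x y
      proof -
        have xy: "x \<in> S" "y \<in> S" using that less.prems(3) by auto
        consider "i < x" "x < k" | "i < y" "y < k" | "x \<le> i \<or> k \<le> x" "y \<le> i \<or> k \<le> y"
          by force
        then show ?thesis
        proof cases
          case 1
          then show ?thesis
            using noncrossing_chord_side[OF less.prems(6,4) ik(1) that] xy by (auto simp: S1_def)
        next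
          case 2
          then show ?thesis
            using noncrossing_chord_side[OF less.prems(6,4) ik(1) symD[OF that]] xy
            by (auto simp: S1_def)
        next
          case 3 then show ?thesis using xy by (auto simp: S2_def)
        qed
      qed
      then show ?thesis by (auto simp: R1_def R2_def)
    qed
    have "R1 \<inter> R2 = {(i, k), (k, i)}"
    proof -
      have "R1 \<inter> R2 = R \<inter> {i, k} \<times> {i, k}" using S(2) by (auto simp: R1_def R2_def)
      then show ?thesis using ik(1) symD less.prems(5) by (auto simp: irrefl_def)
    qed
    then have cR: "card R1 + card R2 = card R + 2"
      using card_Un_Int[of R1 R2] finR R ik(2) by auto
    have T: "ordered_triangles R1 \<union> ordered_triangles R2 \<subseteq> ordered_triangles R"
      using R by (auto simp: ordered_triangles_def)
    have "ordered_triangles R1 \<inter> ordered_triangles R2 = {}"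
    proof -
      have False if "(x, y, z) \<in> ordered_triangles R1" "(x, y, z) \<in> ordered_triangles R2" for x y z
      proof -
        have "x \<in> S1 \<inter> S2" "y \<in> S1 \<inter> S2" "z \<in> S1 \<inter> S2" "x < y" "y < z"
          using that by (auto simp: ordered_triangles_def R1_def R2_def)
        then show False using S(2) by auto
      qed
      then show ?thesis by auto
    qed
    then have "card (ordered_triangles R1) + card (ordered_triangles R2)
        \<le> card (ordered_triangles R)"
      using T finR R card_mono[OF finite_ordered_triangles[OF finR] T]
      by (metis card_Un_disjoint finite_Un finite_ordered_triangles)
    moreover have "card R1 + 4 \<le> 3 * card S1 + card (ordered_triangles R1)"
      using less.prems ge(1) fin
      by (intro less.hyps[OF lt(1)])
         (auto simp: R1_def sym_def irrefl_def intro: noncrossing_mono)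
    moreover have "card R2 + 4 \<le> 3 * card S2 + card (ordered_triangles R2)"
      using less.prems ge(2) fin
      by (intro less.hyps[OF lt(2)])
         (auto simp: R2_def sym_def irrefl_def intro: noncrossing_mono)
    ultimately show ?thesis using cR cS by linarith
  next
    case False
    define H where "H = {(i, j)\<in>R. i < j}"
    have cH: "card R = 2 * card H"
      unfolding H_def by (rule card_sym_irrefl[OF finR less.prems(4,5)])
    have HS: "H \<subseteq> {(i, k). i \<in> S \<and> k \<in> S \<and> i < k}" using less.prems(3) by (auto simp: H_def)
    have ne: "S \<noteq> {}" using less.prems(2) by auto
    have HleS: "card H \<le> card S"
    proof (rule card_consecutive_pairs[OF less.prems(1) ne HS])
      fix i k j assume *: "(i, k) \<in> H" "j \<in> S" "i < j" "j < k"
      then have "i \<in> S" "k \<in> S" "(i, k) \<in> R" "i < k" using HS by (auto simp: H_def)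
      moreover have "i \<le> l \<and> l \<le> k" if "l \<in> S" for l
        using False * that \<open>(i, k) \<in> R\<close> \<open>i < k\<close> by (meson not_le)
      ultimately show "i = Min S \<and> k = Max S"
        using less.prems(1) by (metis Max_eqI Min_eqI)
    qed
    \<comment> \<open>From m \<le> n the bound follows once n \<ge> 4. For n = 2 there is at most
      one edge, and for n = 3 a third edge is paid for by the triangle it closes.\<close>
    consider "card S = 2" | "card S = 3" | "card S \<ge> 4" using less.prems(2) by linarith
    then show ?thesis
    proof cases
      case 1
      then obtain a b where ab: "S = {a, b}" by (auto simp: card_2_iff)
      have "e = (min a b, max a b)" if "e \<in> H" for e
      proof -
        have "fst e \<in> S" "snd e \<in> S" "fst e < snd e" using subsetD[OF HS that] by auto
        then show ?thesis unfolding ab by (cases e) (auto simp: min_def max_def)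
      qed
      then have "H \<subseteq> {(min a b, max a b)}" by blast
      then have "card H \<le> 1" using card_mono[of "{(min a b, max a b)}" H] by simp
      then show ?thesis using 1 cH by simp
    next
      case 2
      show ?thesis
      proof (cases "card H \<le> 2")
        case True then show ?thesis using 2 cH by simp
      next
        case False
        define a where "a = Min S"
        define d where "d = Max S"
        have aS: "a \<in> S" "d \<in> S" using less.prems(1) ne by (auto simp: a_def d_def)
        have "\<not> S \<subseteq> {a, d}"
          using 2 card_mono[of "{a, d}" S] by (auto simp: card_insert_if split: if_splits)
        then obtain b where b: "b \<in> S" "b \<noteq> a" "b \<noteq> d" by auto
        have ord: "a < b" "b < d"
          using b less.prems(1) by (auto simp: a_def d_def order.strict_iff_order)
        have "{a, b, d} = S"
          using 2 aS b ord less.prems(1) by (intro card_subset_eq) auto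
        then have SD: "x = a \<or> x = b \<or> x = d" if "x \<in> S" for x using that by blast
        have "e \<in> {(a, b), (b, d), (a, d)}" if "e \<in> H" for e
        proof -
          have "fst e \<in> S" "snd e \<in> S" "fst e < snd e" using subsetD[OF HS that] by auto
          then show ?thesis using ord SD[of "fst e"] SD[of "snd e"] by (cases e) auto
        qed
        then have "H \<subseteq> {(a, b), (b, d), (a, d)}" by blast
        moreover have "card {(a, b), (b, d), (a, d)} \<le> 3" by (simp add: card_insert_if)
        then have "card {(a, b), (b, d), (a, d)} \<le> card H" using False by linarith
        ultimately have "H = {(a, b), (b, d), (a, d)}"
          using card_seteq[of "{(a, b), (b, d), (a, d)}" H] by blast
        then have "(a, b) \<in> R" "(b, d) \<in> R" "(a, d) \<in> R" by (auto simp: H_def)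
        then have "(a, b, d) \<in> ordered_triangles R"
          using ord by (auto simp: ordered_triangles_def)
        then have "card (ordered_triangles R) > 0"
          using finite_ordered_triangles[OF finR] card_gt_0_iff by blast
        then show ?thesis using 2 cH HleS by linarith
      qed
    next
      case 3 then show ?thesis using cH HleS by linarith
    qed
  qed
qed

section \<open>Minimal chords and vertices of small degree\<close>

text \<open>Any edge passing over a vertex of \<open>S\<close> counts as a chord, even one from
  \<open>Min S\<close> to \<open>Max S\<close>. Minimality refers to nesting.\<close>

definition minimal_chord :: "nat set \<Rightarrow> (nat \<times> nat) set \<Rightarrow> nat \<Rightarrow> nat \<Rightarrow> bool" where
  "minimal_chord S R i k \<longleftrightarrow> (i, k) \<in> R \<and> (\<exists>u\<in>S. i < u \<and> u < k) \<and>
     (\<forall>x y z. (x, y) \<in> R \<longrightarrow> i \<le> x \<longrightarrow> y \<le> k \<longrightarrow> z \<in> S \<longrightarrow> x < z \<longrightarrow> z < y \<longrightarrow> x = i \<and> y = k)"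

text \<open>A chord of least length \<open>k - i\<close> is minimal. Chords exist because
  \<open>Max S\<close> has two neighbours, both smaller, and its edge to the lower one passes over
  the other.\<close>

lemma exists_minimal_chord:
  fixes S :: "nat set"
  assumes "finite S" "S \<noteq> {}" "R \<subseteq> S \<times> S" "sym R" "irrefl R"
    and deg: "\<And>x. x \<in> S \<Longrightarrow> card (R `` {x}) \<ge> 2"
  obtains i k where "minimal_chord S R i k"
proof -
  define P where "P = (\<lambda>(i, k). (i, k) \<in> R \<and> (\<exists>u\<in>S. i < u \<and> u < k))"
  have "\<exists>e. P e"
  proof (rule ccontr)
    assume no: "\<nexists>e. P e"
    define m where "m = Max S"
    have m: "m \<in> S" "\<And>x. x \<in> S \<Longrightarrow> x \<le> m" using assms by (auto simp: m_def)
    have uniq: "x = y" if "(m, x) \<in> R" "(m, y) \<in> R" for x y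
    proof -
      have xy: "x \<in> S" "y \<in> S" "x < m" "y < m" "(x, m) \<in> R" "(y, m) \<in> R"
        using that assms(3,5) symD[OF assms(4)] m(2)
        by (auto simp: irrefl_def order.strict_iff_order)
      then have "\<not> x < y" "\<not> y < x" using no by (auto simp: P_def)
      then show ?thesis by simp
    qed
    have "R `` {m} \<subseteq> {SOME x. (m, x) \<in> R}"
      using uniq someI[of "\<lambda>x. (m, x) \<in> R"] by blast
    then have "card (R `` {m}) \<le> 1" using card_mono[of "{SOME x. (m, x) \<in> R}"] by simp
    then show False using deg[OF m(1)] by simp
  qed
  then obtain e where e: "P e" "\<And>f. P f \<Longrightarrow> snd e - fst e \<le> snd f - fst f"
    using ex_has_least_nat[of P _ "\<lambda>f. snd f - fst f"] by blast
  obtain i k where ik: "e = (i, k)" by force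
  have "x = i \<and> y = k" if *: "(x, y) \<in> R" "i \<le> x" "y \<le> k" "z \<in> S" "x < z" "z < y" for x y z
  proof -
    have "k - i \<le> y - x" using e(2)[of "(x, y)"] ik * by (auto simp: P_def)
    then show ?thesis using * by linarith
  qed
  then have "minimal_chord S R i k" using e(1) ik by (auto simp: P_def minimal_chord_def)
  then show ?thesis by (rule that)
qed

text \<open>The neighbours of a vertex strictly under a minimal chord are its predecessor or
  successor in \<open>S\<close>: the chord confines them, and skipping a vertex would give another
  chord nested in the first.\<close>

lemma minimal_chord_neighbour:
  assumes "R \<subseteq> S \<times> S" "sym R" "irrefl R" "noncrossing R" "minimal_chord S R i k"
    and u: "u \<in> S" "i < u" "u < k" and uw: "(u, w) \<in> R" and z: "z \<in> S"
  shows "i \<le> w" "w \<le> k" "w \<noteq> u" "\<not> (u < z \<and> z < w)" "\<not> (w < z \<and> z < u)"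
proof -
  have ik: "(i, k) \<in> R" and min: "\<And>x y z. (x, y) \<in> R \<Longrightarrow> i \<le> x \<Longrightarrow> y \<le> k \<Longrightarrow> z \<in> S \<Longrightarrow>
      x < z \<Longrightarrow> z < y \<Longrightarrow> x = i \<and> y = k"
    using assms(5) by (auto simp: minimal_chord_def)
  show "w \<noteq> u" using uw assms(3) by (auto simp: irrefl_def)
  have "i \<le> w \<and> w \<le> k" using noncrossing_chord_side[OF assms(4,2) ik uw u(2,3)] .
  then show w: "i \<le> w" "w \<le> k" by auto
  show "\<not> (u < z \<and> z < w)" using min[OF uw] u w z by auto
  show "\<not> (w < z \<and> z < u)" using min[OF symD[OF assms(2) uw]] u w z by auto
qed

lemma card_two_sided:
  fixes A :: "nat set"
  assumes "\<And>x y. x \<in> A \<Longrightarrow> y \<in> A \<Longrightarrow> x < u \<Longrightarrow> y < u \<Longrightarrow> x = y"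
    and "\<And>x y. x \<in> A \<Longrightarrow> y \<in> A \<Longrightarrow> u < x \<Longrightarrow> u < y \<Longrightarrow> x = y"
    and "u \<notin> A"
  shows "card A \<le> 2"
proof -
  \<comment> \<open>On an empty side \<open>SOME\<close> yields an arbitrary value, which only
    enlarges the covering set.\<close>
  have "A \<subseteq> {SOME x. x \<in> A \<and> x < u, SOME x. x \<in> A \<and> u < x}"
  proof
    fix x assume x: "x \<in> A"
    then consider "x < u" | "u < x" using assms(3) by (metis linorder_neqE)
    then show "x \<in> {SOME x. x \<in> A \<and> x < u, SOME x. x \<in> A \<and> u < x}"
    proof cases
      case 1
      then have "(SOME x. x \<in> A \<and> x < u) = x" using x assms(1) by (intro some_equality) auto
      then show ?thesis by simp
    next
      case 2
      then have "(SOME x. x \<in> A \<and> u < x) = x" using x assms(2) by (intro some_equality) auto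
      then show ?thesis by simp
    qed
  qed
  from card_mono[OF _ this] show ?thesis by (simp add: card_insert_if split: if_splits)
qed

lemma minimal_chord_card_le:
  assumes "R \<subseteq> S \<times> S" "sym R" "irrefl R" "noncrossing R" "minimal_chord S R i k"
    and u: "u \<in> S" "i < u" "u < k"
  shows "card (R `` {u}) \<le> 2"
proof (rule card_two_sided[of _ u])
  note nb = minimal_chord_neighbour[OF assms]
  show "x = y" if "x \<in> R `` {u}" "y \<in> R `` {u}" "x < u" "y < u" for x y
    using nb(5)[of x y] nb(5)[of y x] that assms(1) by fastforce
  show "x = y" if "x \<in> R `` {u}" "y \<in> R `` {u}" "u < x" "u < y" for x y
    using nb(4)[of x y] nb(4)[of y x] that assms(1) by fastforce
  show "u \<notin> R `` {u}" using assms(3) by (auto simp: irrefl_def)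
qed

text \<open>If all degrees were at least 3, a minimal chord would exist, and a vertex under it has
  degree at most 2.\<close>

lemma exists_card_le_2:
  fixes S :: "nat set"
  assumes "finite S" "S \<noteq> {}" "R \<subseteq> S \<times> S" "sym R" "irrefl R" "noncrossing R"
  shows "\<exists>u\<in>S. card (R `` {u}) \<le> 2"
proof (rule ccontr)
  assume neg: "\<not> ?thesis"
  then have "\<And>x. x \<in> S \<Longrightarrow> card (R `` {x}) \<ge> 2" by force
  from exists_minimal_chord[OF assms(1-5) this] obtain i k where m: "minimal_chord S R i k" by metis
  then obtain u where "u \<in> S" "i < u" "u < k" by (auto simp: minimal_chord_def)
  with minimal_chord_card_le[OF assms(3-6) m] neg show False by blast
qed

section \<open>Greedy 3-colouring\<close>

lemma exists_colour:
  assumes "finite A" "card A \<le> 2"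
  obtains t where "t \<in> {1..3::nat}" "t \<notin> c ` A"
proof -
  have "card (c ` A) \<le> 2" using card_image_le[OF assms(1), of c] assms(2) by linarith
  then have "\<not> {1..3::nat} \<subseteq> c ` A"
    using card_mono[of "c ` A" "{1..3::nat}"] assms(1) by auto
  then show ?thesis using that by blast
qed

lemma proper3_extend:
  assumes "proper3 (R \<inter> (- {u}) \<times> (- {u})) c" "sym R" "irrefl R"
    and "t \<in> {1..3}" "t \<notin> c ` (R `` {u})"
  shows "proper3 R (c(u := t))"
proof -
  have "(c(u := t)) x \<noteq> (c(u := t)) y" if xy: "(x, y) \<in> R" for x y
  proof -
    have "x \<noteq> y" "(y, x) \<in> R" using xy assms(2,3) by (auto simp: irrefl_def dest: symD)
    then show ?thesis using xy assms(1,5) by (auto simp: proper3_def)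
  qed
  moreover have "range (c(u := t)) \<subseteq> {1..3}" using assms(1,4) by (auto simp: proper3_def)
  ultimately show ?thesis unfolding proper3_def by blast
qed

lemma noncrossing_proper3:
  fixes S :: "nat set"
  assumes "finite S" "R \<subseteq> S \<times> S" "sym R" "irrefl R" "noncrossing R"
  shows "\<exists>c. proper3 R c"
  using assms
proof (induction "card S" arbitrary: S R)
  case 0
  then have "R = {}" by auto
  then show ?case by (intro exI[of _ "\<lambda>_. 1"]) (auto simp: proper3_def)
next
  case (Suc n)
  from exists_card_le_2[OF Suc.prems(1) _ Suc.prems(2-5)] Suc.hyps(2)
  obtain u where u: "u \<in> S" "card (R `` {u}) \<le> 2" by fastforce
  let ?R = "R \<inter> (- {u}) \<times> (- {u})"
  have "\<exists>c. proper3 ?R c"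
    using Suc.prems Suc.hyps(2) u(1)
    by (intro Suc.hyps(1)[of "S - {u}"])
       (auto simp: sym_def irrefl_def intro: noncrossing_mono)
  then obtain c where c: "proper3 ?R c" by blast
  have "finite (R `` {u})" using Suc.prems(1,2) finite_subset[of "R `` {u}" S] by blast
  from exists_colour[OF this u(2), of c] obtain t where "t \<in> {1..3}" "t \<notin> c ` (R `` {u})" .
  from proper3_extend[OF c Suc.prems(3,4) this] show ?case by blast
qed

section \<open>Colourings that separate two given vertices\<close>

lemma proper3_overrideI:
  assumes "sym R" "range c \<subseteq> {1..3}"
    and "\<And>x y. (x, y) \<in> R \<Longrightarrow> x \<in> X \<Longrightarrow> c x \<noteq> c y"
    and "\<And>x y. (x, y) \<in> R \<Longrightarrow> x \<notin> X \<Longrightarrow> y \<notin> X \<Longrightarrow> c x \<noteq> c y"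
  shows "proper3 R c"
proof -
  have "c x \<noteq> c y" if "(x, y) \<in> R" for x y
    using assms(3)[OF that] assms(3)[OF symD[OF assms(1) that]] assms(4)[OF that] by metis
  then show ?thesis using assms(2) by (auto simp: proper3_def)
qed

lemma card_3_third:
  assumes "card A = 3" "x \<in> A" "y \<in> A" "x \<noteq> y"
  obtains z where "A = {x, y, z}" "z \<noteq> x" "z \<noteq> y"
proof -
  have "finite A" using assms(1) card.infinite by fastforce
  then have "card (A - {x, y}) = 1" using assms by (simp add: card_Diff_subset)
  then obtain z where "A - {x, y} = {z}" by (auto simp: card_1_singleton_iff)
  then have "A = {x, y, z}" "z \<noteq> x" "z \<noteq> y" using assms by auto
  then show ?thesis by (rule that)
qed

lemma range_fun_upd_subset: "range f \<subseteq> A \<Longrightarrow> t \<in> A \<Longrightarrow> range (f(x := t)) \<subseteq> A"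
  by auto

lemma third_colour:
  obtains t where "t \<in> {1..3::nat}" "t \<noteq> p" "t \<noteq> q"
proof -
  have "card {p, q} \<le> 2" by (simp add: card_insert_if)
  then obtain t where "t \<in> {1..3}" "t \<notin> id ` {p, q}" using exists_colour[of "{p, q}" id] by auto
  then show ?thesis using that[of t] by simp
qed

lemma other_two_colours:
  assumes "t \<in> {1..3::nat}"
  obtains t1 t2 where "t1 \<in> {1..3}" "t2 \<in> {1..3}" "t1 \<noteq> t" "t2 \<noteq> t" "t1 \<noteq> t2"
proof -
  have "t = 1 \<or> t = 2 \<or> t = 3" using assms by force
  then show ?thesis using that[of 1 2] that[of 1 3] that[of 2 3] by force
qed

text \<open>List colouring of a triangle, with \<open>p\<close>, \<open>q\<close>, \<open>r\<close>
  forbidden at its three corners. If all three agreed, only two colours would remain; as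
  \<open>p \<noteq> q\<close>, a cyclic shift of \<open>t\<close>, \<open>p\<close>,
  \<open>q\<close> works, where \<open>t\<close> is the third colour.\<close>

lemma triangle_colours:
  assumes "p \<in> {1..3::nat}" "q \<in> {1..3::nat}" "r \<in> {1..3::nat}" "p \<noteq> q"
  obtains x y z where "x \<in> {1..3}" "y \<in> {1..3}" "z \<in> {1..3}"
    "x \<noteq> y" "y \<noteq> z" "x \<noteq> z" "x \<noteq> p" "y \<noteq> q" "z \<noteq> r"
proof -
  obtain t where t: "t \<in> {1..3}" "t \<noteq> p" "t \<noteq> q" using third_colour .
  show ?thesis
  proof (cases "r = q")
    case True then show ?thesis using that[of q t p] assms t by auto
  next
    case False then show ?thesis using that[of t p q] assms t by auto
  qed
qed

text \<open>An edge \<open>(r, s)\<close> with both ends off the interval from \<open>a\<close> to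
  \<open>b\<close> cannot separate \<open>a2\<close> from \<open>b2\<close>: if it passes over one
  of them, it passes over \<open>a\<close> and \<open>b\<close> and hence weakly over the
  other.\<close>

lemma noncrossing_shortcut_side:
  assumes "noncrossing R" "sym R" "a < b" "(a, a2) \<in> R" "(b, b2) \<in> R" "(r, s) \<in> R"
    and "\<not> (a \<le> r \<and> r \<le> b)" "\<not> (a \<le> s \<and> s \<le> b)"
  shows "r < a2 \<Longrightarrow> a2 < s \<Longrightarrow> r \<le> b2 \<and> b2 \<le> s" "r < b2 \<Longrightarrow> b2 < s \<Longrightarrow> r \<le> a2 \<and> a2 \<le> s"
proof -
  note side = noncrossing_chord_side[OF assms(1,2,6)]
  show "r \<le> b2 \<and> b2 \<le> s" if "r < a2" "a2 < s"
  proof -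
    have "r \<le> a \<and> a \<le> s" using side[OF symD[OF assms(2,4)]] that by blast
    then have "r < b" "b < s" using assms(3,7,8) by force+
    then show ?thesis using side[OF assms(5)] by blast
  qed
  show "r \<le> a2 \<and> a2 \<le> s" if "r < b2" "b2 < s"
  proof -
    have "r \<le> b \<and> b \<le> s" using side[OF symD[OF assms(2,5)]] that by blast
    then have "r < a" "a < s" using assms(3,7,8) by force+
    then show ?thesis using side[OF assms(4)] by blast
  qed
qed

text \<open>The triangle \<open>u a b\<close> is attached to the rest only through the third
  neighbours \<open>a2\<close> of \<open>a\<close> and \<open>b2\<close> of \<open>b\<close>. If
  these coincide, the common vertex is recoloured together with the triangle; otherwise different
  colours are forced on them.\<close>

lemma ear_colouring:
  fixes S :: "nat set"
  assumes fin: "finite S" and RS: "R \<subseteq> S \<times> S" and R: "sym R" "irrefl R" "noncrossing R"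
    and uv: "u \<in> S" "v \<in> S" "u \<noteq> v" "(u, v) \<notin> R" "\<And>w. (u, w) \<in> R \<Longrightarrow> (v, w) \<notin> R"
    and ab: "(a, b) \<in> R" "a < u" "u < b" "R `` {u} = {a, b}"
      "\<And>z. z \<in> S \<Longrightarrow> a < z \<Longrightarrow> z < b \<Longrightarrow> z = u"
    and deg: "\<And>x. x \<in> S \<Longrightarrow> x \<noteq> u \<Longrightarrow> x \<noteq> v \<Longrightarrow> card (R `` {x}) = 3"
  shows "\<exists>c. proper3 R c \<and> c u \<noteq> c v"
proof -
  note sym = symD[OF R(1)]
  have irr: "(x, x) \<notin> R" for x using R(2) by (auto simp: irrefl_def)
  have ua: "(u, a) \<in> R" "(u, b) \<in> R" using ab(4) by auto
  have S: "a \<in> S" "b \<in> S" using ab(1) RS by auto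
  have vab: "v \<noteq> a" "v \<noteq> b" using ua uv(4) by auto
  obtain a2 where a2: "R `` {a} = {u, b, a2}" "a2 \<noteq> u" "a2 \<noteq> b"
    using card_3_third[OF deg[of a], of u b] S vab ab(1-3) sym[OF ua(1)] by auto
  obtain b2 where b2: "R `` {b} = {u, a, b2}" "b2 \<noteq> u" "b2 \<noteq> a"
    using card_3_third[OF deg[of b], of u a] S vab ab(2,3) sym[OF ab(1)] sym[OF ua(2)] by auto
  have nb: "(a, a2) \<in> R" "(b, b2) \<in> R" using a2(1) b2(1) by auto
  have "a2 \<noteq> a" "b2 \<noteq> b" using nb irr by auto
  have S2: "a2 \<in> S" "b2 \<in> S" using nb RS by auto
  show ?thesis
  proof (cases "a2 = b2")
    case True
    define w where "w = a2"
    have w: "w \<in> S" "w \<noteq> u" "w \<noteq> a" "w \<noteq> b" "(w, a) \<in> R" "(w, b) \<in> R"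
      using True a2 b2 nb S2 sym \<open>a2 \<noteq> a\<close> by (auto simp: w_def)
    \<comment> \<open>\<open>w\<close> shares the neighbour \<open>a\<close> with \<open>u\<close>,
      which \<open>v\<close> does not, so \<open>w\<close> also has degree 3.\<close>
    have "w \<noteq> v" using uv(5)[OF ua(1)] w(5) by auto
    obtain w' where w': "R `` {w} = {a, b, w'}" "w' \<noteq> a" "w' \<noteq> b"
      using card_3_third[OF deg[of w], of a b] w \<open>w \<noteq> v\<close> ab(2,3) by auto
    let ?X = "{u, a, b, w}"
    have "w' \<noteq> w" using w'(1) irr by auto
    have "w' \<noteq> u"
    proof
      assume "w' = u"
      then have "(u, w) \<in> R" using w'(1) sym by blast
      then show False using ab(4) w by auto
    qed
    have "\<exists>c. proper3 (R \<inter> (- ?X) \<times> (- ?X)) c"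
      using fin RS R
      by (intro noncrossing_proper3[of S])
         (auto simp: sym_def irrefl_def intro: noncrossing_mono)
    then obtain c where c: "proper3 (R \<inter> (- ?X) \<times> (- ?X)) c" by blast
    \<comment> \<open>\<open>u\<close> and \<open>w\<close> are not adjacent and may share the
      colour \<open>t\<close>, which avoids the colours of \<open>v\<close> and of
      \<open>w'\<close>, the only neighbour of \<open>w\<close> outside \<open>?X\<close>. The
      neighbours of \<open>a\<close> and \<open>b\<close> all lie in \<open>?X\<close>, so these two
      take the remaining colours.\<close>
    obtain t where t: "t \<in> {1..3}" "t \<noteq> c v" "t \<noteq> c w'"
      using third_colour .
    obtain t1 t2 where t12: "t1 \<in> {1..3}" "t2 \<in> {1..3}" "t1 \<noteq> t" "t2 \<noteq> t" "t1 \<noteq> t2"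
      using other_two_colours[OF t(1)] .
    let ?c = "c(w := t, u := t, a := t1, b := t2)"
    have val: "?c u = t" "?c a = t1" "?c b = t2" "?c w = t" "?c w' = c w'" "?c v = c v"
      "\<And>x. x \<notin> ?X \<Longrightarrow> ?c x = c x"
      using w ab(2,3) w' \<open>w' \<noteq> w\<close> \<open>w' \<noteq> u\<close> \<open>w \<noteq> v\<close> vab uv(3) by auto
    have "proper3 R ?c"
    proof (rule proper3_overrideI[OF R(1), of _ ?X])
      show "range ?c \<subseteq> {1..3}"
        using c t(1) t12(1,2) unfolding proper3_def by (intro range_fun_upd_subset) auto
      show "?c x \<noteq> ?c y" if xy: "(x, y) \<in> R" "x \<in> ?X" for x y
      proof -
        have y: "y \<in> R `` {x}" using xy(1) by simp
        consider "x = u" | "x = a" | "x = b" | "x = w" using xy(2) by blast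
        then show ?thesis
        proof cases
          case 1
          then have "y = a \<or> y = b" using y ab(4) by auto
          then show ?thesis using 1 val t12 by metis
        next
          case 2
          then have "y = u \<or> y = b \<or> y = w" using y a2(1) by (auto simp: w_def)
          then show ?thesis using 2 val t12 by metis
        next
          case 3
          then have "y = u \<or> y = a \<or> y = w" using y b2(1) True by (auto simp: w_def)
          then show ?thesis using 3 val t12 by metis
        next
          case 4
          then have "y = a \<or> y = b \<or> y = w'" using y w'(1) by auto
          then show ?thesis using 4 val t12 t by metis
        qed
      qed
      show "?c x \<noteq> ?c y" if "(x, y) \<in> R" "x \<notin> ?X" "y \<notin> ?X" for x y
        using c that val(7)[OF that(2)] val(7)[OF that(3)] by (auto simp: proper3_def)
    qed
    moreover have "?c u \<noteq> ?c v" using val t by metis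
    ultimately show ?thesis by blast
  next
    case False
    let ?X = "{u, a, b}"
    have X: "a2 \<notin> ?X" "b2 \<notin> ?X" using a2 b2 \<open>a2 \<noteq> a\<close> \<open>b2 \<noteq> b\<close> by auto
    \<comment> \<open>The extra edge makes the colours of \<open>a2\<close> and \<open>b2\<close>
      differ, as \<open>triangle_colours\<close> requires; its third forbidden colour will be that
      of \<open>v\<close>.\<close>
    define R' where "R' = R \<inter> (- ?X) \<times> (- ?X) \<union> {(a2, b2), (b2, a2)}"
    have out: "\<not> (a \<le> r \<and> r \<le> b)" if "r \<in> S" "r \<notin> ?X" for r
      using ab(5)[OF that(1)] that(2) by (auto simp: order.order_iff_strict)
    \<comment> \<open>The new edge \<open>a2 b2\<close> can be drawn along the path \<open>a2, a, b, b2\<close>, as nothing but \<open>u\<close> lies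
      between \<open>a\<close> and \<open>b\<close>.\<close>
    have nc: "noncrossing R'"
      unfolding noncrossing_def
    proof (intro allI impI notI)
      fix i j k l assume *: "i < j" "j < k" "k < l" "(i, k) \<in> R'" "(j, l) \<in> R'"
      have side: "(r < a2 \<longrightarrow> a2 < s \<longrightarrow> r \<le> b2 \<and> b2 \<le> s) \<and> (r < b2 \<longrightarrow> b2 < s \<longrightarrow> r \<le> a2 \<and> a2 \<le> s)"
        if "(r, s) \<in> R" "r \<notin> ?X" "s \<notin> ?X" for r s
        using noncrossing_shortcut_side[OF R(3,1) _ nb that(1)] out[of r] out[of s] that RS ab(2,3)
        by auto
      consider "(i, k) \<in> R" "(j, l) \<in> R"
        | "(i, k) \<in> R" "i \<notin> ?X" "k \<notin> ?X" "j = a2 \<and> l = b2 \<or> j = b2 \<and> l = a2"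
        | "(j, l) \<in> R" "j \<notin> ?X" "l \<notin> ?X" "i = a2 \<and> k = b2 \<or> i = b2 \<and> k = a2"
        | "i = a2 \<and> k = b2 \<or> i = b2 \<and> k = a2" "j = a2 \<and> l = b2 \<or> j = b2 \<and> l = a2"
        using *(4,5) unfolding R'_def by blast
      then show False
      proof cases
        case 1 then show False using noncrossingD[OF R(3)] * by blast
      next
        case 2 then show False using side[OF 2(1-3)] *(1-3) by auto
      next
        case 3 then show False using side[OF 3(1-3)] *(1-3) by auto
      next
        case 4 then show False using *(1-3) by auto
      qed
    qed
    have "R' \<subseteq> S \<times> S" using RS S2 by (auto simp: R'_def)
    moreover have "sym R'" using sym by (auto simp: R'_def sym_def)
    moreover have "irrefl R'" using irr False by (auto simp: R'_def irrefl_def)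
    ultimately obtain c where c: "proper3 R' c" using noncrossing_proper3[OF fin _ _ _ nc] by blast
    have rng: "c x \<in> {1..3}" for x using c unfolding proper3_def by blast
    have c2: "c a2 \<noteq> c b2" using c by (auto simp: proper3_def R'_def)
    obtain ta tb tu where t: "ta \<in> {1..3}" "tb \<in> {1..3}" "tu \<in> {1..3}"
      "ta \<noteq> tb" "tb \<noteq> tu" "ta \<noteq> tu" "ta \<noteq> c a2" "tb \<noteq> c b2" "tu \<noteq> c v"
      using triangle_colours[OF rng[of a2] rng[of b2] rng[of v] c2] .
    let ?c = "c(a := ta, b := tb, u := tu)"
    have val: "?c u = tu" "?c a = ta" "?c b = tb" "?c a2 = c a2" "?c b2 = c b2" "?c v = c v"
      "\<And>x. x \<notin> ?X \<Longrightarrow> ?c x = c x"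
      using ab(2,3) X vab uv(3) by auto
    have "proper3 R ?c"
    proof (rule proper3_overrideI[OF R(1), of _ ?X])
      show "range ?c \<subseteq> {1..3}"
        using c t(1-3) unfolding proper3_def by (intro range_fun_upd_subset) auto
      show "?c x \<noteq> ?c y" if xy: "(x, y) \<in> R" "x \<in> ?X" for x y
      proof -
        have y: "y \<in> R `` {x}" using xy(1) by simp
        consider "x = u" | "x = a" | "x = b" using xy(2) by blast
        then show ?thesis
        proof cases
          case 1
          then have "y = a \<or> y = b" using y ab(4) by auto
          then show ?thesis using 1 val t by metis
        next
          case 2
          then have "y = u \<or> y = b \<or> y = a2" using y a2(1) by auto
          then show ?thesis using 2 val t by metis
        next
          case 3
          then have "y = u \<or> y = a \<or> y = b2" using y b2(1) by auto
          then show ?thesis using 3 val t by metis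
        qed
      qed
      show "?c x \<noteq> ?c y" if "(x, y) \<in> R" "x \<notin> ?X" "y \<notin> ?X" for x y
        using c that val(7)[OF that(2)] val(7)[OF that(3)] by (auto simp: proper3_def R'_def)
    qed
    moreover have "?c u \<noteq> ?c v" using val t by metis
    ultimately show ?thesis by blast
  qed
qed

text \<open>Counting \<open>v\<close> as one more neighbour of \<open>u\<close> still leaves at most
  two forbidden colours.\<close>

lemma low_degree_colouring:
  fixes S :: "nat set"
  assumes "finite S" "R \<subseteq> S \<times> S" "sym R" "irrefl R" "noncrossing R"
    and "u \<noteq> v" "card (R `` {u}) \<le> 1"
  shows "\<exists>c. proper3 R c \<and> c u \<noteq> c v"
proof -
  let ?R = "R \<inter> (- {u}) \<times> (- {u})"
  have "\<exists>c. proper3 ?R c"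
    using assms
    by (intro noncrossing_proper3[of S])
       (auto simp: sym_def irrefl_def intro: noncrossing_mono)
  then obtain c where c: "proper3 ?R c" by blast
  have "finite (R `` {u})" using assms(1,2) finite_subset[of "R `` {u}" S] by blast
  then have "finite (insert v (R `` {u}))" "card (insert v (R `` {u})) \<le> 2"
    using assms(7) by (auto simp: card_insert_if)
  from exists_colour[OF this, of c] obtain t where t: "t \<in> {1..3}" "t \<notin> c ` insert v (R `` {u})" .
  then have "proper3 R (c(u := t))" using proper3_extend[OF c assms(3,4)] by blast
  then show ?thesis using t(2) assms(6) by (intro exI[of _ "c(u := t)"]) auto
qed

text \<open>The two neighbours of \<open>x\<close> lie between \<open>i\<close> and
  \<open>k\<close>, but not strictly, so they are \<open>i\<close> and \<open>k\<close>. They are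
  also next to \<open>x\<close> in \<open>S\<close>, so nothing else fits under the chord.\<close>

lemma minimal_chord_ear:
  assumes "R \<subseteq> S \<times> S" "sym R" "irrefl R" "noncrossing R" "minimal_chord S R i k"
    and x: "x \<in> S" "i < x" "x < k" "card (R `` {x}) = 2"
    and inner: "\<And>z. (x, z) \<in> R \<Longrightarrow> \<not> (i < z \<and> z < k)"
  shows "R `` {x} = {i, k}" "\<And>z. z \<in> S \<Longrightarrow> i < z \<Longrightarrow> z < k \<Longrightarrow> z = x"
proof -
  note nb = minimal_chord_neighbour[OF assms(1-5) x(1-3)]
  have "R `` {x} \<subseteq> {i, k}"
  proof
    fix z assume "z \<in> R `` {x}"
    then have "(x, z) \<in> R" by simp
    then have "i \<le> z" "z \<le> k" "\<not> (i < z \<and> z < k)" using nb(1,2)[OF _ x(1)] inner by auto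
    then show "z \<in> {i, k}" by auto
  qed
  moreover have "card {i, k} = 2" using x by auto
  ultimately show *: "R `` {x} = {i, k}" using x(4) by (intro card_subset_eq) auto
  then have R: "(x, i) \<in> R" "(x, k) \<in> R" by auto
  show "z = x" if "z \<in> S" "i < z" "z < k" for z
    using nb(5)[OF R(1) that(1)] nb(4)[OF R(2) that(1)] that by auto
qed

text \<open>Vertices of degree at most 2 other than \<open>u\<close> and \<open>v\<close> are
  removed by induction, and degree at most 1 at \<open>u\<close> or \<open>v\<close> is settled
  directly. In the remaining case the edge bound fixes all degrees, and a minimal chord cuts off
  just \<open>u\<close> or just \<open>v\<close>.\<close>

lemma noncrossing_separating_colouring:
  fixes S :: "nat set"
  assumes "finite S" "R \<subseteq> S \<times> S" "sym R" "irrefl R" "noncrossing R"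
    and "u \<in> S" "v \<in> S" "u \<noteq> v" "(u, v) \<notin> R" "\<And>w. (u, w) \<in> R \<Longrightarrow> (v, w) \<notin> R"
    and "card (ordered_triangles R) \<le> 2"
  shows "\<exists>c. proper3 R c \<and> c u \<noteq> c v"
  using assms
proof (induction "card S" arbitrary: S R rule: less_induct)
  case less
  note fin = less.prems(1) and RS = less.prems(2) and R = less.prems(3-5) and uv = less.prems(6-10)
  have finR: "finite R" using fin RS by (meson finite_SigmaI finite_subset)
  have finN: "finite (R `` {x})" for x using fin RS finite_subset[of "R `` {x}" S] by blast
  consider w where "w \<in> S" "w \<noteq> u" "w \<noteq> v" "card (R `` {w}) \<le> 2"
    | "card (R `` {u}) \<le> 1" | "card (R `` {v}) \<le> 1"
    | "\<And>x. x \<in> S \<Longrightarrow> (if x = u \<or> x = v then 2 else 3) \<le> card (R `` {x})"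
  proof (cases "(\<exists>w\<in>S. w \<noteq> u \<and> w \<noteq> v \<and> card (R `` {w}) \<le> 2) \<or>
      card (R `` {u}) \<le> 1 \<or> card (R `` {v}) \<le> 1")
    case True then show ?thesis using that(1-3) by blast
  next
    case False
    then have "(if x = u \<or> x = v then 2 else 3) \<le> card (R `` {x})" if "x \<in> S" for x
      using that by (auto simp: not_le)
    then show ?thesis by (rule that(4))
  qed
  then show ?case
  proof cases
    case 1
    let ?R = "R \<inter> (- {w}) \<times> (- {w})"
    have "card (ordered_triangles ?R) \<le> 2"
    proof -
      have "ordered_triangles ?R \<subseteq> ordered_triangles R" by (auto simp: ordered_triangles_def)
      from card_mono[OF finite_ordered_triangles[OF finR] this] less.prems(11)
      show ?thesis by linarith
    qed
    moreover have "card (S - {w}) < card S" using fin 1(1) by (rule card_Diff1_less)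
    ultimately have "\<exists>c. proper3 ?R c \<and> c u \<noteq> c v"
      using less.prems 1
      by (intro less.hyps[of "S - {w}"])
         (auto simp: sym_def irrefl_def intro: noncrossing_mono)
    then obtain c where c: "proper3 ?R c" "c u \<noteq> c v" by blast
    from exists_colour[OF finN 1(4), of c] obtain t where "t \<in> {1..3}" "t \<notin> c ` (R `` {w})" .
    from proper3_extend[OF c(1) R(1,2) this] have "proper3 R (c(w := t))" .
    then show ?thesis using c(2) 1(2,3) by (intro exI[of _ "c(w := t)"]) auto
  next
    case 2
    then show ?thesis using low_degree_colouring[OF fin RS R uv(3)] by blast
  next
    case 3
    then show ?thesis using low_degree_colouring[OF fin RS R uv(3)[symmetric]] by metis
  next
    case 4
    \<comment> \<open>\<open>?d\<close> bounds the degrees from below; \<open>u\<close> and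
      \<open>v\<close> get only 2 because the edge joining them is absent from \<open>R\<close>. Its
      sum 3n - 2 equals the upper bound 3n - 4 + 2 on \<open>card R\<close>, so all degrees are
      exact.\<close>
    let ?d = "\<lambda>x. if x = u \<or> x = v then 2 else 3 :: nat"
    have R_eq: "card R = (\<Sum>x\<in>S. card (R `` {x}))"
    proof -
      have "R = (SIGMA x:S. R `` {x})" using RS by auto
      then have "card R = card (SIGMA x:S. R `` {x})" by (rule arg_cong)
      also have "\<dots> = (\<Sum>x\<in>S. card (R `` {x}))" using fin finN by simp
      finally show ?thesis .
    qed
    have two: "card {u, v} = 2" "{u, v} \<subseteq> S" using uv by auto
    then have ge2: "card S \<ge> 2" using card_mono[OF fin two(2)] by simp
    have "sum ?d S = sum ?d {u, v} + sum ?d (S - {u, v})"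
      using sum.subset_diff[OF two(2) fin, of ?d] by (simp only: add.commute)
    also have "sum ?d {u, v} = 4" using uv(3) by simp
    also have "sum ?d (S - {u, v}) = 3 * (card S - 2)"
      using two fin by (simp add: card_Diff_subset)
    finally have d: "sum ?d S = 3 * card S - 2" using ge2 by simp
    have "card R \<le> 3 * card S - 2"
      using noncrossing_card_le[OF fin ge2 RS R] less.prems(11) by linarith
    moreover have "sum ?d S \<le> card R" unfolding R_eq by (rule sum_mono) (use 4 in auto)
    ultimately have "sum ?d S = (\<Sum>x\<in>S. card (R `` {x}))" using d R_eq by linarith
    from sum_mono_inv[OF this] have deg: "card (R `` {x}) = ?d x" if "x \<in> S" for x
      using 4 that fin by metis
    then have "\<And>x. x \<in> S \<Longrightarrow> 2 \<le> card (R `` {x})" by simp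
    then obtain i k where m: "minimal_chord S R i k"
      using exists_minimal_chord[OF fin _ RS R(1,2)] uv(1) by blast
    then obtain x where x: "x \<in> S" "i < x" "x < k" and ik: "(i, k) \<in> R"
      by (auto simp: minimal_chord_def)
    \<comment> \<open>Vertices under the chord have degree at most 2, so only \<open>u\<close> and
      \<open>v\<close> qualify. As these are not adjacent, \<open>x\<close> has no neighbour
      strictly under the chord.\<close>
    have inner: "z = u \<or> z = v" if "z \<in> S" "i < z" "z < k" for z
      using minimal_chord_card_le[OF RS R m that] deg[OF that(1)] by (auto split: if_splits)
    have "\<not> (i < z \<and> z < k)" if "(x, z) \<in> R" for z
    proof
      assume "i < z \<and> z < k"
      then have "z = u \<or> z = v" using inner[of z] that RS by blast
      moreover have "x = u \<or> x = v" using inner x by blast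
      moreover have "(v, u) \<notin> R" "(x, x) \<notin> R" using uv(4) R by (auto simp: irrefl_def dest: symD)
      ultimately show False using that uv(4) by blast
    qed
    moreover have "card (R `` {x}) = 2" using inner[OF x] deg[OF x(1)] by auto
    ultimately have ear: "R `` {x} = {i, k}" "\<And>z. z \<in> S \<Longrightarrow> i < z \<Longrightarrow> z < k \<Longrightarrow> z = x"
      using minimal_chord_ear[OF RS R m x] by blast+
    have deg3: "card (R `` {y}) = 3" if "y \<in> S" "y \<noteq> u" "y \<noteq> v" for y
      using deg[OF that(1)] that by simp
    show ?thesis
    proof (cases "x = u")
      case True
      show ?thesis
        by (rule ear_colouring[OF fin RS R uv ik x(2,3)[unfolded True] ear(1)[unfolded True]
              ear(2)[unfolded True] deg3])
    next
      case False
      then have xv: "x = v" using inner x by blast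
      have "(v, u) \<notin> R" "\<And>w. (v, w) \<in> R \<Longrightarrow> (u, w) \<notin> R"
        using uv(4,5) symD[OF R(1)] by blast+
      then have "\<exists>c. proper3 R c \<and> c v \<noteq> c u"
        by (rule ear_colouring[OF fin RS R uv(2,1) uv(3)[symmetric] _ _ ik x(2,3)[unfolded xv]
              ear(1)[unfolded xv] ear(2)[unfolded xv] deg3])
      then show ?thesis by metis
    qed
  qed
qed

section \<open>Theta curves\<close>

text \<open>The Jordan curve theorem for \<open>c1\<close> followed by the reverse of
  \<open>c2\<close>.\<close>

lemma Jordan_arcs:
  fixes c1 c2 :: "real \<Rightarrow> complex"
  assumes "arc c1" "pathstart c1 = a" "pathfinish c1 = b"
    and "arc c2" "pathstart c2 = a" "pathfinish c2 = b"
    and "path_image c1 \<inter> path_image c2 = {a, b}"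
  shows "inside (path_image c1 \<union> path_image c2) \<noteq> {}"
    and "connected (inside (path_image c1 \<union> path_image c2))"
    and "connected (outside (path_image c1 \<union> path_image c2))"
    and "frontier (inside (path_image c1 \<union> path_image c2)) = path_image c1 \<union> path_image c2"
proof -
  let ?c = "c1 +++ reversepath c2"
  have "simple_path ?c"
    using assms by (intro simple_path_join_loop) (auto simp: arc_reversepath)
  moreover have "pathfinish ?c = pathstart ?c" using assms by simp
  moreover have "path_image ?c = path_image c1 \<union> path_image c2"
    using assms by (simp add: path_image_join)
  ultimately show "inside (path_image c1 \<union> path_image c2) \<noteq> {}"
    "connected (inside (path_image c1 \<union> path_image c2))"
    "connected (outside (path_image c1 \<union> path_image c2))"
    "frontier (inside (path_image c1 \<union> path_image c2)) = path_image c1 \<union> path_image c2"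
    using Jordan_inside_outside[of ?c] by simp_all
qed

lemma connected_subset_inside:
  assumes "connected C" "C \<inter> X = {}" "z \<in> C" "z \<in> inside X"
  shows "C \<subseteq> inside X"
proof
  fix y assume "y \<in> C"
  then have "connected_component (- X) z y"
    using assms unfolding connected_component_def by (intro exI[of _ C]) auto
  then show "y \<in> inside X" using assms(4) inside_same_component by blast
qed

lemma connected_subset_outside:
  assumes "connected C" "C \<inter> X = {}" "z \<in> C" "z \<in> outside X"
  shows "C \<subseteq> outside X"
proof
  fix y assume "y \<in> C"
  then have "connected_component (- X) z y"
    using assms unfolding connected_component_def by (intro exI[of _ C]) auto
  then show "y \<in> outside X" using assms(4) outside_same_component by blast
qed

text \<open>Each inside is connected and misses the other closed curve, so if they met, each would
  contain the other. Equal insides have equal frontiers, but the open arc of \<open>c2\<close> is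
  nonempty and misses \<open>c1\<close> and \<open>c3\<close>.\<close>

lemma theta_insides_disjoint:
  fixes c1 c2 c3 :: "real \<Rightarrow> complex"
  assumes c1: "arc c1" "pathstart c1 = a" "pathfinish c1 = b"
    and c2: "arc c2" "pathstart c2 = a" "pathfinish c2 = b"
    and c3: "arc c3" "pathstart c3 = a" "pathfinish c3 = b"
    and int12: "path_image c1 \<inter> path_image c2 = {a, b}"
    and int13: "path_image c1 \<inter> path_image c3 = {a, b}"
    and int23: "path_image c2 \<inter> path_image c3 = {a, b}"
    and out2: "path_image c2 - {a, b} \<subseteq> outside (path_image c1 \<union> path_image c3)"
    and out3: "path_image c3 - {a, b} \<subseteq> outside (path_image c1 \<union> path_image c2)"
  shows "inside (path_image c1 \<union> path_image c2) \<inter> inside (path_image c1 \<union> path_image c3) = {}"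
proof (rule ccontr)
  let ?I2 = "inside (path_image c1 \<union> path_image c2)"
  let ?I3 = "inside (path_image c1 \<union> path_image c3)"
  assume "?I2 \<inter> ?I3 \<noteq> {}"
  then obtain z where z: "z \<in> ?I2" "z \<in> ?I3" by blast
  have disj: "?I2 \<inter> (path_image c1 \<union> path_image c2) = {}" "?I3 \<inter> (path_image c1 \<union> path_image c3) = {}"
    "?I2 \<inter> outside (path_image c1 \<union> path_image c2) = {}"
    "?I3 \<inter> outside (path_image c1 \<union> path_image c3) = {}"
    using inside_no_overlap by auto
  have "?I2 \<inter> (path_image c1 \<union> path_image c3) = {}" using disj out3 int13 by blast
  then have "?I2 \<subseteq> ?I3"
    using connected_subset_inside[OF Jordan_arcs(2)[OF c1 c2 int12]] z by blast
  moreover have "?I3 \<inter> (path_image c1 \<union> path_image c2) = {}" using disj out2 int12 by blast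
  then have "?I3 \<subseteq> ?I2"
    using connected_subset_inside[OF Jordan_arcs(2)[OF c1 c3 int13]] z by blast
  ultimately have "frontier ?I2 = frontier ?I3" by simp
  then have "path_image c1 \<union> path_image c2 = path_image c1 \<union> path_image c3"
    using Jordan_arcs(4)[OF c1 c2 int12] Jordan_arcs(4)[OF c1 c3 int13] by simp
  moreover have "path_image c2 - {a, b} \<noteq> {}"
    using nonempty_simple_path_endless[OF arc_imp_simple_path[OF c2(1)]] c2 by simp
  ultimately show False using int12 int23 by blast
qed

text \<open>If all three open arcs were outside, a point inside \<open>c1 \<union> c2\<close> would lie outside both
  \<open>c1 \<union> c3\<close> and \<open>c2 \<union> c3\<close>, whose intersection \<open>c3\<close> is connected, and Janiszewski's theorem would
  connect it to infinity.\<close>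

lemma theta_not_all_outside:
  fixes c1 c2 c3 :: "real \<Rightarrow> complex"
  assumes c1: "arc c1" "pathstart c1 = a" "pathfinish c1 = b"
    and c2: "arc c2" "pathstart c2 = a" "pathfinish c2 = b"
    and c3: "arc c3" "pathstart c3 = a" "pathfinish c3 = b"
    and int12: "path_image c1 \<inter> path_image c2 = {a, b}"
    and int13: "path_image c1 \<inter> path_image c3 = {a, b}"
    and int23: "path_image c2 \<inter> path_image c3 = {a, b}"
    and out1: "path_image c1 - {a, b} \<subseteq> outside (path_image c2 \<union> path_image c3)"
    and out2: "path_image c2 - {a, b} \<subseteq> outside (path_image c1 \<union> path_image c3)"
    and out3: "path_image c3 - {a, b} \<subseteq> outside (path_image c1 \<union> path_image c2)"
  shows False
proof -
  let ?S = "path_image c1 \<union> path_image c3"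
  let ?T = "path_image c2 \<union> path_image c3"
  let ?U = "path_image c1 \<union> path_image c2"
  have compact: "compact ?S" "compact ?T" "compact (?S \<union> ?T)"
    using c1(1) c2(1) c3(1) by (auto intro!: compact_Un compact_arc_image)
  obtain z where z: "z \<in> inside ?U" using Jordan_arcs(1)[OF c1 c2 int12] by blast
  \<comment> \<open>\<open>w\<close> plays the role of infinity: lying outside the whole theta
    curve, it lies outside each of its three closed curves.\<close>
  obtain w where w: "w \<in> outside (?S \<union> ?T)"
    using outside_bounded_nonempty[OF compact_imp_bounded[OF compact(3)]] by blast
  have wST: "w \<in> outside ?S" "w \<in> outside ?T" "w \<in> outside ?U"
    using w outside_mono[of ?S "?S \<union> ?T"] outside_mono[of ?T "?S \<union> ?T"]
      outside_mono[of ?U "?S \<union> ?T"] by auto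
  have zU: "z \<notin> ?U" "z \<notin> outside ?U"
    using z inside_no_overlap[of ?U] inside_Int_outside[of ?U] by (metis disjoint_iff)+
  have "z \<notin> path_image c3"
  proof
    assume "z \<in> path_image c3"
    then have "z \<in> {a, b}" using out3 zU(2) by blast
    then show False using int12 zU(1) by blast
  qed
  then have zST: "z \<notin> ?S" "z \<notin> ?T" using zU(1) by auto
  have "z \<notin> inside ?S"
    using theta_insides_disjoint[OF c1 c2 c3 int12 int13 int23 out2 out3] z by (metis disjoint_iff)
  moreover have "z \<notin> inside ?T"
    using theta_insides_disjoint[OF c2 c1 c3 _ int23 int13 out1] int12 out3 z
    by (metis disjoint_iff Un_commute Int_commute)
  ultimately have zo: "z \<in> outside ?S" "z \<in> outside ?T"
    using zST inside_Un_outside[of ?S] inside_Un_outside[of ?T] by (metis ComplI UnE)+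
  have "outside ?S \<subseteq> - ?S" "outside ?T \<subseteq> - ?T"
    using inside_Un_outside[of ?S] inside_Un_outside[of ?T] by (metis Un_upper2)+
  then have "connected_component (- ?S) z w" "connected_component (- ?T) z w"
    using wST zo Jordan_arcs(3)[OF c1 c3 int13] Jordan_arcs(3)[OF c2 c3 int23]
    unfolding connected_component_def by metis+
  moreover have "?S \<inter> ?T = path_image c3" using int12 int13 int23 by blast
  then have "connected (?S \<inter> ?T)" using c3(1) connected_arc_image by simp
  ultimately have "connected_component (- (?S \<union> ?T)) z w"
    using Janiszewski[OF compact(1) compact_imp_closed[OF compact(2)]] by simp
  then have "connected_component (- ?U) z w"
    by (rule connected_component_of_subset) auto
  then have "w \<in> inside ?U" using z by (rule inside_same_component)
  then show False using wST(3) inside_Int_outside[of ?U] by (metis disjoint_iff)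
qed

text \<open>By continuity the ends of an arc are limits of its interior. This will make the end
  vertices of a chord limits of the open chord.\<close>

lemma path_image_subset_closure_endless:
  assumes "arc d"
  shows "path_image d \<subseteq> closure (path_image d - {pathstart d, pathfinish d})"
proof -
  have "d ` closure {0<..<1} \<subseteq> closure (d ` {0<..<1})"
    using assms by (intro image_closure_subset closure_subset closed_closure)
      (auto simp: arc_def path_def)
  then show ?thesis
    using simple_path_endless[OF arc_imp_simple_path[OF assms]] by (simp add: path_image_def)
qed

section \<open>Hamiltonian cycles of outerplane graphs\<close>

fun path_edges :: "'a list \<Rightarrow> 'a set set" where
  "path_edges (x # y # zs) = insert {x, y} (path_edges (y # zs))"
| "path_edges _ = {}"

lemma path_edges_subset: "f \<in> path_edges vs \<Longrightarrow> f \<subseteq> set vs"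
  by (induction vs rule: path_edges.induct) auto

lemma path_edges_append:
  "path_edges (xs @ x # ys) = path_edges (xs @ [x]) \<union> path_edges (x # ys)"
proof (induction xs)
  case Nil then show ?case by simp
next
  case (Cons z xs) then show ?case by (cases xs) auto
qed

lemma path_edges_snoc:
  "xs \<noteq> [] \<Longrightarrow> path_edges (xs @ [y]) = insert {last xs, y} (path_edges xs)"
  by (induction xs rule: path_edges.induct) auto

lemma path_edges_rev: "path_edges (rev vs) = path_edges vs"
proof (induction vs rule: path_edges.induct)
  case (1 x y zs)
  have "path_edges (rev (x # y # zs)) = path_edges (rev zs @ y # [x])" by simp
  also have "\<dots> = path_edges (rev (y # zs)) \<union> path_edges [y, x]"
    using path_edges_append[of "rev zs" y "[x]"] by simp
  finally show ?case using 1 by (auto simp: insert_commute)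
qed auto

text \<open>\<open>x\<close> occurs only in the first edge, and with an inner vertex present the
  other end of that edge is not \<open>y\<close>. So such a path never runs along the edge
  \<open>xy\<close>.\<close>

lemma ends_notin_path_edges:
  assumes "distinct (x # L @ [y])" "L \<noteq> []"
  shows "{x, y} \<notin> path_edges (x # L @ [y])"
proof -
  obtain z L' where L: "L = z # L'" using assms(2) by (cases L) auto
  have "x \<notin> set (z # L' @ [y])" using assms(1) L by simp
  then have "{x, y} \<notin> path_edges (z # L' @ [y])" using path_edges_subset by blast
  moreover have "{x, y} \<noteq> {x, z}" using assms(1) L by (auto simp: doubleton_eq_iff)
  ultimately show ?thesis using L by simp
qed

text \<open>Follow a walk from \<open>w\<close>, stop at its first vertex in \<open>C\<close> and
  cut out loops.\<close>

lemma first_hit_path: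
  assumes "(w, b) \<in> {(x, y). {x, y} \<in> E}\<^sup>*" "w \<notin> C" "b \<in> C"
  shows "\<exists>ws y. distinct (w # ws) \<and> set (w # ws) \<inter> C = {} \<and> y \<in> C \<and>
     path_edges (w # ws @ [y]) \<subseteq> E"
  using assms
proof (induction rule: converse_rtrancl_induct)
  case base then show ?case by simp
next
  case (step w z)
  show ?case
  proof (cases "z \<in> C")
    case True then show ?thesis using step by (intro exI[of _ "[]"] exI[of _ z]) auto
  next
    case False
    then obtain ws y where ws: "distinct (z # ws)" "set (z # ws) \<inter> C = {}" "y \<in> C"
      "path_edges (z # ws @ [y]) \<subseteq> E" using step by blast
    show ?thesis
    proof (cases "w \<in> set (z # ws)")
      \<comment> \<open>The path from \<open>z\<close> already visits \<open>w\<close>, so its tail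
        from \<open>w\<close> on is used.\<close>
      case True
      then obtain as bs where ab: "z # ws = as @ w # bs" by (meson split_list)
      then have "z # ws @ [y] = as @ w # bs @ [y]" by (metis append_Cons append_assoc)
      then have "path_edges (w # bs @ [y]) \<subseteq> E"
        using ws(4) path_edges_append[of as w "bs @ [y]"] by (metis Un_subset_iff)
      then show ?thesis using ws(1-3) unfolding ab by (intro exI[of _ bs] exI[of _ y]) auto
    next
      case False
      then show ?thesis using ws step by (intro exI[of _ "z # ws"] exI[of _ y]) auto
    qed
  qed
qed

section \<open>Paths drawn in the plane\<close>

locale outerplane_graph =
  fixes G :: "'a graph" and p :: "'a \<Rightarrow> complex" and \<gamma> :: "'a set \<Rightarrow> real \<Rightarrow> complex"
  assumes simple: "simple_graph G" and outerplane: "outerplane G p \<gamma>"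
begin

definition track :: "'a list \<Rightarrow> complex set" where
  "track vs = (\<Union>f\<in>path_edges vs. path_image (\<gamma> f))"

lemma inj: "inj_on p (verts G)"
  using outerplane by (simp add: outerplane_def plane_embedding_def)

lemma edge:
  assumes "f \<in> edges G"
  shows "f \<subseteq> verts G" "card f = 2" "arc (\<gamma> f)" "{pathstart (\<gamma> f), pathfinish (\<gamma> f)} = p ` f"
    "(path_image (\<gamma> f) - p ` f) \<inter> p ` verts G = {}"
  using assms simple outerplane
  by (auto simp: simple_graph_def outerplane_def plane_embedding_def)

lemma edge_Int:
  assumes "f \<in> edges G" "g \<in> edges G" "f \<noteq> g"
  shows "path_image (\<gamma> f) \<inter> path_image (\<gamma> g) \<subseteq> p ` (f \<inter> g)"
proof
  fix q assume q: "q \<in> path_image (\<gamma> f) \<inter> path_image (\<gamma> g)"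
  have "(path_image (\<gamma> f) - p ` f) \<inter> path_image (\<gamma> g) = {}"
    "(path_image (\<gamma> g) - p ` g) \<inter> path_image (\<gamma> f) = {}"
    using assms outerplane unfolding outerplane_def plane_embedding_def by metis+
  then have "q \<in> p ` f \<inter> p ` g" using q by blast
  then show "q \<in> p ` (f \<inter> g)"
    using inj_on_image_Int[OF inj edge(1)[OF assms(1)] edge(1)[OF assms(2)]] by simp
qed

lemma vertex_on_edge:
  assumes "f \<in> edges G" "v \<in> verts G"
  shows "p v \<in> path_image (\<gamma> f) \<longleftrightarrow> v \<in> f"
proof
  assume "p v \<in> path_image (\<gamma> f)"
  then have "p v \<in> p ` f" using edge(5)[OF assms(1)] assms(2) by blast
  then show "v \<in> f" using inj edge(1)[OF assms(1)] assms(2) by (meson inj_on_image_mem_iff)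
next
  assume "v \<in> f"
  then have "p v \<in> {pathstart (\<gamma> f), pathfinish (\<gamma> f)}" using edge(4)[OF assms(1)] by simp
  then show "p v \<in> path_image (\<gamma> f)" by auto
qed

lemma vertex_on_track:
  assumes "path_edges vs \<subseteq> edges G" "v \<in> verts G" "p v \<in> track vs"
  shows "v \<in> set vs"
proof -
  obtain f where "f \<in> path_edges vs" "p v \<in> path_image (\<gamma> f)"
    using assms(3) by (auto simp: track_def)
  then show ?thesis using vertex_on_edge assms(1,2) path_edges_subset by blast
qed

lemma set_subset_verts:
  assumes "path_edges vs \<subseteq> edges G" "length vs \<ge> 2"
  shows "set vs \<subseteq> verts G"
  using assms
proof (induction vs rule: path_edges.induct)
  case (1 x y zs)
  then have "{x, y} \<subseteq> verts G" using edge(1)[of "{x, y}"] by simp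
  then show ?case using 1 by (cases zs) auto
qed auto

lemma track_Int:
  assumes "path_edges vs \<subseteq> edges G" "path_edges ws \<subseteq> edges G"
    and "path_edges vs \<inter> path_edges ws = {}"
  shows "track vs \<inter> track ws \<subseteq> p ` (set vs \<inter> set ws)"
proof
  fix q assume "q \<in> track vs \<inter> track ws"
  then obtain f g where fg: "f \<in> path_edges vs" "g \<in> path_edges ws"
    "q \<in> path_image (\<gamma> f) \<inter> path_image (\<gamma> g)" by (auto simp: track_def)
  then have "f \<noteq> g" using assms(3) by blast
  then have "q \<in> p ` (f \<inter> g)" using edge_Int[of f g] fg assms(1,2) by blast
  then show "q \<in> p ` (set vs \<inter> set ws)" using fg(1,2) path_edges_subset by blast
qed

text \<open>The arcs of the edges are joined one after another. As \<open>x\<close> does not recur,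
  the first edge meets the rest of the track only in \<open>p y\<close>.\<close>

lemma track_arc:
  assumes "distinct vs" "length vs \<ge> 2" "path_edges vs \<subseteq> edges G"
  shows "\<exists>g. arc g \<and> pathstart g = p (hd vs) \<and> pathfinish g = p (last vs) \<and> path_image g = track vs"
  using assms
proof (induction vs rule: path_edges.induct)
  case (1 x y zs)
  have xy: "{x, y} \<in> edges G" using 1 by simp
  have base: "\<exists>g. arc g \<and> pathstart g = p x \<and> pathfinish g = p y \<and> path_image g = path_image (\<gamma> {x, y})"
  proof -
    have "pathstart (\<gamma> {x, y}) = p x \<and> pathfinish (\<gamma> {x, y}) = p y \<or>
        pathstart (\<gamma> {x, y}) = p y \<and> pathfinish (\<gamma> {x, y}) = p x"
      using edge(4)[OF xy] by (auto simp: doubleton_eq_iff)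
    then show ?thesis
    proof
      assume "pathstart (\<gamma> {x, y}) = p x \<and> pathfinish (\<gamma> {x, y}) = p y"
      then show ?thesis using edge(3)[OF xy] by blast
    next
      assume "pathstart (\<gamma> {x, y}) = p y \<and> pathfinish (\<gamma> {x, y}) = p x"
      then show ?thesis using edge(3)[OF xy]
        by (intro exI[of _ "reversepath (\<gamma> {x, y})"]) (simp add: arc_reversepath)
    qed
  qed
  then obtain g where g: "arc g" "pathstart g = p x" "pathfinish g = p y"
    "path_image g = path_image (\<gamma> {x, y})" by blast
  show ?case
  proof (cases zs)
    case Nil then show ?thesis using base by (simp add: track_def)
  next
    case (Cons z zs')
    then obtain h where h: "arc h" "pathstart h = p y" "pathfinish h = p (last (y # zs))"
      "path_image h = track (y # zs)" using 1 by auto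
    have "{x, y} \<notin> path_edges (y # zs)"
      using path_edges_subset[of "{x, y}" "y # zs"] 1(2) by auto
    then have "track [x, y] \<inter> track (y # zs) \<subseteq> p ` (set [x, y] \<inter> set (y # zs))"
      using 1 by (intro track_Int) auto
    also have "set [x, y] \<inter> set (y # zs) = {y}" using 1(2) by auto
    finally have "path_image g \<inter> path_image h \<subseteq> {pathstart h}"
      using g h by (simp add: track_def)
    then have "arc (g +++ h)" using g h by (intro arc_join) auto
    moreover have "path_image (g +++ h) = track (x # y # zs)"
      using g h by (simp add: path_image_join track_def)
    ultimately show ?thesis using g h by (intro exI[of _ "g +++ h"]) (simp add: Cons)
  qed
qed auto

text \<open>A shared edge would be \<open>{x, y}\<close>, which a path with inner vertices does not
  use. \<open>M\<close> may be empty, so the edge \<open>xy\<close> itself is covered as a second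
  path.\<close>

lemma tracks_meet:
  assumes "distinct (x # L @ [y])" "distinct (x # M @ [y])" "set L \<inter> set M = {}" "L \<noteq> []"
    and "path_edges (x # L @ [y]) \<subseteq> edges G" "path_edges (x # M @ [y]) \<subseteq> edges G"
  shows "track (x # L @ [y]) \<inter> track (x # M @ [y]) = {p x, p y}"
proof
  have common: "set (x # L @ [y]) \<inter> set (x # M @ [y]) = {x, y}" using assms(1-3) by auto
  have "path_edges (x # L @ [y]) \<inter> path_edges (x # M @ [y]) = {}"
  proof (rule ccontr)
    assume "\<not> ?thesis"
    then obtain f where f: "f \<in> path_edges (x # L @ [y])" "f \<in> path_edges (x # M @ [y])" by blast
    then have "f \<subseteq> {x, y}" using path_edges_subset[OF f(1)] path_edges_subset[OF f(2)] common by blast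
    moreover have "card f = 2" using f(1) assms(5) edge(2) by blast
    moreover have "card {x, y} = 2" using assms(1) by simp
    ultimately have "f = {x, y}" by (intro card_subset_eq) auto
    then show False using f(1) ends_notin_path_edges[OF assms(1,4)] by simp
  qed
  from track_Int[OF assms(5,6) this]
  show "track (x # L @ [y]) \<inter> track (x # M @ [y]) \<subseteq> {p x, p y}" unfolding common by simp
  have ends: "{p x, p y} \<subseteq> track (x # N @ [y])"
    if N: "distinct (x # N @ [y])" "path_edges (x # N @ [y]) \<subseteq> edges G" for N
  proof -
    obtain g where "pathstart g = p x" "pathfinish g = p y" "path_image g = track (x # N @ [y])"
      using track_arc[OF N(1) _ N(2)] by auto
    then show ?thesis by (metis empty_subsetI insert_subset pathfinish_in_path_image pathstart_in_path_image)
  qed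
  show "{p x, p y} \<subseteq> track (x # L @ [y]) \<inter> track (x # M @ [y])"
    using ends[OF assms(1,5)] ends[OF assms(2,6)] by blast
qed

lemma closed_track: "path_edges vs \<subseteq> edges G \<Longrightarrow> closed (track vs)"
proof -
  assume *: "path_edges vs \<subseteq> edges G"
  have "finite (path_edges vs)" by (induction vs rule: path_edges.induct) auto
  then show ?thesis
    unfolding track_def using * edge(3) by (intro closed_UN ballI closed_arc_image) auto
qed

section \<open>Consequences of all vertices lying on the outer face\<close>

text \<open>\<open>inside X\<close> is open, so if it contained a vertex it would meet the outer
  face, of which that vertex is a limit. But the outer face lies in
  \<open>outside X\<close>.\<close>

lemma vertex_not_inside:
  assumes "v \<in> verts G" "closed X" "X \<subseteq> drawing G p \<gamma>"
  shows "p v \<notin> inside X"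
proof
  assume "p v \<in> inside X"
  moreover have "p v \<in> closure (outside (drawing G p \<gamma>))"
    using outerplane assms(1) by (auto simp: outerplane_def frontier_def)
  ultimately have "inside X \<inter> outside (drawing G p \<gamma>) \<noteq> {}"
    using open_Int_closure_eq_empty[OF open_inside[OF assms(2)]] by blast
  then show False using outside_mono[OF assms(3)] inside_Int_outside[of X] by blast
qed

lemma track_subset_drawing: "path_edges vs \<subseteq> edges G \<Longrightarrow> track vs \<subseteq> drawing G p \<gamma>"
  by (auto simp: track_def drawing_def)

text \<open>The open track is connected, misses the other two and contains a vertex, because
  \<open>L\<close> is nonempty. That vertex is not inside, so the whole open track is
  outside.\<close>

lemma endless_outside:
  assumes "distinct (x # L @ [y])" "L \<noteq> []" "path_edges (x # L @ [y]) \<subseteq> edges G"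
    and "distinct (x # M @ [y])" "path_edges (x # M @ [y]) \<subseteq> edges G" "set L \<inter> set M = {}"
    and "distinct (x # N @ [y])" "path_edges (x # N @ [y]) \<subseteq> edges G" "set L \<inter> set N = {}"
  shows "track (x # L @ [y]) - {p x, p y} \<subseteq> outside (track (x # M @ [y]) \<union> track (x # N @ [y]))"
proof -
  let ?X = "track (x # M @ [y]) \<union> track (x # N @ [y])"
  obtain g where g: "arc g" "pathstart g = p x" "pathfinish g = p y" "path_image g = track (x # L @ [y])"
    using track_arc[OF assms(1) _ assms(3)] by auto
  obtain z L' where L: "L = z # L'" using assms(2) by (cases L) auto
  have zV: "z \<in> verts G" "x \<in> verts G" "y \<in> verts G"
    using set_subset_verts[OF assms(3)] L by auto
  have "p z \<in> track (x # L @ [y])"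
    using vertex_on_edge[of "{x, z}" z] assms(3) zV(1) L by (auto simp: track_def)
  moreover have "p z \<noteq> p x" "p z \<noteq> p y"
    using inj_onD[OF inj, of z x] inj_onD[OF inj, of z y] zV assms(1) L by auto
  ultimately have z: "p z \<in> track (x # L @ [y]) - {p x, p y}" by simp
  have "connected (track (x # L @ [y]) - {p x, p y})"
    using connected_simple_path_endless[OF arc_imp_simple_path[OF g(1)]] g by simp
  moreover have disj: "(track (x # L @ [y]) - {p x, p y}) \<inter> ?X = {}"
    using tracks_meet[OF assms(1,4,6,2,3,5)] tracks_meet[OF assms(1,7,9,2,3,8)] by blast
  moreover have "p z \<notin> inside ?X"
    using zV(1) closed_track[OF assms(5)] closed_track[OF assms(8)]
      track_subset_drawing[OF assms(5)] track_subset_drawing[OF assms(8)]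
    by (intro vertex_not_inside) auto
  then have "p z \<in> outside ?X" using z disj inside_Un_outside[of ?X] by blast
  ultimately show ?thesis using connected_subset_outside z by blast
qed

text \<open>All three open tracks would lie outside the closed curve formed by the other two. In
  effect this excludes subdivisions of the complete bipartite graph with parts of size 2 and
  3.\<close>

lemma no_theta:
  assumes "distinct (x # L @ [y])" "path_edges (x # L @ [y]) \<subseteq> edges G" "L \<noteq> []"
    and "distinct (x # M @ [y])" "path_edges (x # M @ [y]) \<subseteq> edges G" "M \<noteq> []"
    and "distinct (x # N @ [y])" "path_edges (x # N @ [y]) \<subseteq> edges G" "N \<noteq> []"
    and disj: "set L \<inter> set M = {}" "set L \<inter> set N = {}" "set M \<inter> set N = {}"
  shows False
proof -
  obtain f where f: "arc f" "pathstart f = p x" "pathfinish f = p y" "path_image f = track (x # L @ [y])"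
    using track_arc[OF assms(1) _ assms(2)] by auto
  obtain g where g: "arc g" "pathstart g = p x" "pathfinish g = p y" "path_image g = track (x # M @ [y])"
    using track_arc[OF assms(4) _ assms(5)] by auto
  obtain h where h: "arc h" "pathstart h = p x" "pathfinish h = p y" "path_image h = track (x # N @ [y])"
    using track_arc[OF assms(7) _ assms(8)] by auto
  have disj': "set M \<inter> set L = {}" "set N \<inter> set L = {}" "set N \<inter> set M = {}" using disj by auto
  show False
  proof (rule theta_not_all_outside[OF f(1-3) g(1-3) h(1-3)]; unfold f(4) g(4) h(4))
    show "track (x # L @ [y]) \<inter> track (x # M @ [y]) = {p x, p y}"
      "track (x # L @ [y]) \<inter> track (x # N @ [y]) = {p x, p y}"
      "track (x # M @ [y]) \<inter> track (x # N @ [y]) = {p x, p y}"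
      by (rule tracks_meet[OF assms(1,4) disj(1) assms(3,2,5)]
          tracks_meet[OF assms(1,7) disj(2) assms(3,2,8)]
          tracks_meet[OF assms(4,7) disj(3) assms(6,5,8)])+
    show "track (x # L @ [y]) - {p x, p y} \<subseteq> outside (track (x # M @ [y]) \<union> track (x # N @ [y]))"
      by (rule endless_outside[OF assms(1,3,2) assms(4,5) disj(1) assms(7,8) disj(2)])
    show "track (x # M @ [y]) - {p x, p y} \<subseteq> outside (track (x # L @ [y]) \<union> track (x # N @ [y]))"
      by (rule endless_outside[OF assms(4,6,5) assms(1,2) disj'(1) assms(7,8) disj(3)])
    show "track (x # N @ [y]) - {p x, p y} \<subseteq> outside (track (x # L @ [y]) \<union> track (x # M @ [y]))"
      by (rule endless_outside[OF assms(7,9,8) assms(1,2) disj'(2) assms(4,5) disj'(3)])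
  qed
qed

text \<open>The two open tracks with inner vertices lie outside the respective other closed curves,
  so the open chord cannot lie outside as well. Being connected and disjoint from the cycle, it lies
  inside.\<close>

lemma chord_inside:
  assumes "distinct (x # L @ [y])" "path_edges (x # L @ [y]) \<subseteq> edges G" "L \<noteq> []"
    and "distinct (x # M @ [y])" "path_edges (x # M @ [y]) \<subseteq> edges G" "M \<noteq> []"
    and disj: "set L \<inter> set M = {}" and xy: "{x, y} \<in> edges G"
  shows "path_image (\<gamma> {x, y}) - {p x, p y} \<subseteq> inside (track (x # L @ [y]) \<union> track (x # M @ [y]))"
proof -
  let ?X = "track (x # L @ [y]) \<union> track (x # M @ [y])"
  have h0: "distinct (x # [] @ [y])" "path_edges (x # [] @ [y]) \<subseteq> edges G" using assms(1) xy by auto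
  have t: "track (x # [] @ [y]) = path_image (\<gamma> {x, y})" by (simp add: track_def)
  obtain f where f: "arc f" "pathstart f = p x" "pathfinish f = p y" "path_image f = track (x # L @ [y])"
    using track_arc[OF assms(1) _ assms(2)] by auto
  obtain g where g: "arc g" "pathstart g = p x" "pathfinish g = p y" "path_image g = track (x # M @ [y])"
    using track_arc[OF assms(4) _ assms(5)] by auto
  obtain h where h: "arc h" "pathstart h = p x" "pathfinish h = p y" "path_image h = track (x # [] @ [y])"
    using track_arc[OF h0(1) _ h0(2)] by auto
  have meets: "track (x # L @ [y]) \<inter> track (x # M @ [y]) = {p x, p y}"
    "track (x # L @ [y]) \<inter> track (x # [] @ [y]) = {p x, p y}"
    "track (x # M @ [y]) \<inter> track (x # [] @ [y]) = {p x, p y}"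
    using tracks_meet[OF assms(1,4) disj assms(3,2,5)]
      tracks_meet[OF assms(1) h0(1) _ assms(3,2) h0(2)]
      tracks_meet[OF assms(4) h0(1) _ assms(6,5) h0(2)] by auto
  have disj': "set M \<inter> set L = {}" "set M \<inter> set [] = {}" "set L \<inter> set [] = {}" using disj by auto
  have conn: "connected (track (x # [] @ [y]) - {p x, p y})"
    using connected_simple_path_endless[OF arc_imp_simple_path[OF h(1)]] h by simp
  have away: "(track (x # [] @ [y]) - {p x, p y}) \<inter> ?X = {}" using meets by blast
  have "\<not> track (x # [] @ [y]) - {p x, p y} \<subseteq> outside ?X"
  proof
    assume out: "track (x # [] @ [y]) - {p x, p y} \<subseteq> outside ?X"
    show False
      by (rule theta_not_all_outside[OF f(1-3) g(1-3) h(1-3)]; unfold f(4) g(4) h(4))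
        (rule meets out endless_outside[OF assms(1,3,2) assms(4,5) disj h0 disj'(3)]
          endless_outside[OF assms(4,6,5) assms(1,2) disj'(1) h0 disj'(2)])+
  qed
  then obtain z where z: "z \<in> track (x # [] @ [y]) - {p x, p y}" "z \<notin> outside ?X" by blast
  then have "z \<in> inside ?X" using away inside_Un_outside[of ?X] by blast
  then show ?thesis using connected_subset_inside[OF conn away z(1)] t by simp
qed

text \<open>The chord \<open>xy\<close> splits the inside of the cycle into two regions. The open
  chord \<open>uw\<close> is connected, lies inside the cycle and misses \<open>xy\<close>, so it
  would have to stay in one region, yet \<open>u\<close> and \<open>w\<close> lie on different
  sides.\<close>

lemma no_crossing_chords:
  assumes dist: "distinct (x # A @ u # B @ y # C @ w # D)"
    and ed: "path_edges (x # A @ u # B @ y # C @ w # D @ [x]) \<subseteq> edges G"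
    and xy: "{x, y} \<in> edges G" and uw: "{u, w} \<in> edges G"
  shows False
proof -
  \<comment> \<open>\<open>?L\<close> and \<open>?M\<close> are the two ways around the cycle from
    \<open>x\<close> to \<open>y\<close>, and \<open>?L'\<close> and \<open>?M'\<close> those from
    \<open>u\<close> to \<open>w\<close>.\<close>
  let ?L = "A @ u # B" and ?M = "rev (C @ w # D)"
  let ?L' = "B @ y # C" and ?M' = "rev A @ x # rev D"
  have e1: "path_edges (x # A @ u # B @ y # C @ w # D @ [x]) =
      path_edges (x # ?L @ [y]) \<union> path_edges (x # ?M @ [y])"
    using path_edges_append[of "x # A @ u # B" y "C @ w # D @ [x]"]
      path_edges_rev[of "y # C @ w # D @ [x]"] by simp
  have e2: "path_edges (x # A @ u # B @ y # C @ w # D @ [x]) =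
      path_edges (u # ?L' @ [w]) \<union> path_edges (u # ?M' @ [w])"
    using path_edges_append[of "x # A" u "B @ y # C @ w # D @ [x]"]
      path_edges_append[of "u # B @ y # C" w "D @ [x]"]
      path_edges_append[of "u # rev A" x "rev D @ [w]"]
      path_edges_rev[of "x # A @ [u]"] path_edges_rev[of "w # D @ [x]"] by auto
  have L: "distinct (x # ?L @ [y])" "path_edges (x # ?L @ [y]) \<subseteq> edges G" "?L \<noteq> []"
    and M: "distinct (x # ?M @ [y])" "path_edges (x # ?M @ [y]) \<subseteq> edges G" "?M \<noteq> []"
    and LM: "set ?L \<inter> set ?M = {}"
    using dist ed unfolding e1 by auto
  have L': "distinct (u # ?L' @ [w])" "path_edges (u # ?L' @ [w]) \<subseteq> edges G" "?L' \<noteq> []"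
    and M': "distinct (u # ?M' @ [w])" "path_edges (u # ?M' @ [w]) \<subseteq> edges G" "?M' \<noteq> []"
    and LM': "set ?L' \<inter> set ?M' = {}"
    using dist ed unfolding e2 by auto
  let ?c1 = "track (x # ?L @ [y])" and ?c2 = "track (x # ?M @ [y])" and ?c = "path_image (\<gamma> {x, y})"
  have same: "track (u # ?L' @ [w]) \<union> track (u # ?M' @ [w]) = ?c1 \<union> ?c2"
    using e1 e2 unfolding track_def by (metis UN_Un)
  have V: "x \<in> verts G" "y \<in> verts G" "u \<in> verts G" "w \<in> verts G"
    using edge(1)[OF xy] edge(1)[OF uw] by auto
  have c_in: "?c - {p x, p y} \<subseteq> inside (?c1 \<union> ?c2)"
    by (rule chord_inside[OF L M LM xy])
  let ?d = "path_image (\<gamma> {u, w}) - {p u, p w}"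
  have d_in: "?d \<subseteq> inside (?c1 \<union> ?c2)"
    using chord_inside[OF L' M' LM' uw] unfolding same .
  have h0: "distinct (x # [] @ [y])" "path_edges (x # [] @ [y]) \<subseteq> edges G" using L(1) xy by auto
  have t: "track (x # [] @ [y]) = ?c" by (simp add: track_def)
  obtain f where f: "arc f" "pathstart f = p x" "pathfinish f = p y" "path_image f = ?c1"
    using track_arc[OF L(1) _ L(2)] by auto
  obtain g where g: "arc g" "pathstart g = p x" "pathfinish g = p y" "path_image g = ?c2"
    using track_arc[OF M(1) _ M(2)] by auto
  obtain h where h: "arc h" "pathstart h = p x" "pathfinish h = p y" "path_image h = ?c"
    using track_arc[OF h0(1) _ h0(2)] t by auto
  have meets: "?c1 \<inter> ?c2 = {p x, p y}" "?c1 \<inter> ?c = {p x, p y}" "?c2 \<inter> ?c = {p x, p y}"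
    using tracks_meet[OF L(1) M(1) LM L(3,2) M(2)]
      tracks_meet[OF L(1) h0(1) _ L(3,2) h0(2)]
      tracks_meet[OF M(1) h0(1) _ M(3,2) h0(2)] t by auto
  have pxy: "p x \<noteq> p y" using f(1-3) by (metis arc_distinct_ends)
  have "?c - {p x, p y} \<noteq> {}"
    using nonempty_simple_path_endless[OF arc_imp_simple_path[OF h(1)]] h by simp
  then have "?c \<inter> inside (?c1 \<union> ?c2) \<noteq> {}" using c_in by blast
  then obtain I: "inside (?c1 \<union> ?c) \<inter> inside (?c2 \<union> ?c) = {}"
     "inside (?c1 \<union> ?c) \<union> inside (?c2 \<union> ?c) \<union> (?c - {p x, p y}) = inside (?c1 \<union> ?c2)"
    using split_inside_simple_closed_curve[OF arc_imp_simple_path[OF f(1)] f(2,3)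
        arc_imp_simple_path[OF g(1)] g(2,3) arc_imp_simple_path[OF h(1)] h(2,3) pxy]
      meets f(4) g(4) h(4) by metis
  have "{x, y} \<noteq> {u, w}" "{x, y} \<inter> {u, w} = {}" using dist by auto
  then have "?d \<inter> ?c = {}" using edge_Int[OF uw xy] by auto
  then have d_sub: "?d \<subseteq> inside (?c1 \<union> ?c) \<union> inside (?c2 \<union> ?c)" using d_in I(2) by blast
  have pd: "{pathstart (\<gamma> {u, w}), pathfinish (\<gamma> {u, w})} = {p u, p w}" using edge(4)[OF uw] by simp
  have conn: "connected ?d"
    using connected_simple_path_endless[OF arc_imp_simple_path[OF edge(3)[OF uw]]] unfolding pd .
  have cl: "p u \<in> closure ?d" "p w \<in> closure ?d"
    using path_image_subset_closure_endless[OF edge(3)[OF uw]] vertex_on_edge[OF uw] V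
    unfolding pd by auto
  have clos: "closed (?c1 \<union> ?c)" "closed (?c2 \<union> ?c)"
    using closed_track[OF L(2)] closed_track[OF M(2)] closed_arc_image[OF edge(3)[OF xy]] by auto
  have sub: "?c1 \<union> ?c \<subseteq> drawing G p \<gamma>" "?c2 \<union> ?c \<subseteq> drawing G p \<gamma>"
    using track_subset_drawing[OF L(2)] track_subset_drawing[OF M(2)] xy by (auto simp: drawing_def)
  \<comment> \<open>A vertex neither on nor inside a closed curve is not in the closure of its
    inside. Since \<open>p u\<close> and \<open>p w\<close> are both limits of the open chord
    \<open>uw\<close>, it fits into neither region.\<close>
  have "p w \<notin> ?c1 \<union> ?c" "p u \<notin> ?c2 \<union> ?c"
    using vertex_on_track[OF L(2) V(4)] vertex_on_track[OF M(2) V(3)]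
      vertex_on_edge[OF xy V(3)] vertex_on_edge[OF xy V(4)] dist by auto
  then have "p w \<notin> closure (inside (?c1 \<union> ?c))" "p u \<notin> closure (inside (?c2 \<union> ?c))"
    using vertex_not_inside[OF V(4) clos(1) sub(1)] vertex_not_inside[OF V(3) clos(2) sub(2)]
      closure_inside_subset[OF clos(1)] closure_inside_subset[OF clos(2)] by blast+
  then have "\<not> ?d \<subseteq> inside (?c1 \<union> ?c)" "\<not> ?d \<subseteq> inside (?c2 \<union> ?c)"
    using cl closure_mono by blast+
  then have "inside (?c1 \<union> ?c) \<inter> ?d \<noteq> {}" "inside (?c2 \<union> ?c) \<inter> ?d \<noteq> {}" using d_sub by blast+
  then show False
    using connectedD[OF conn open_inside[OF clos(1)] open_inside[OF clos(2)]] I(1) d_sub by blast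
qed

section \<open>From longest cycles to a noncrossing order\<close>

text \<open>A single edge counts as a cyclic list of length 2, so that enlarging cyclic lists can start
  from any edge.\<close>

definition cyclic :: "'a list \<Rightarrow> bool" where
  "cyclic vs \<longleftrightarrow> distinct vs \<and> length vs \<ge> 2 \<and> path_edges (vs @ [hd vs]) \<subseteq> edges G"

lemma cyclic_rotate:
  assumes "cyclic (A @ x # B)"
  shows "cyclic (x # B @ A)"
proof (cases A)
  case Nil then show ?thesis using assms by simp
next
  case (Cons a A')
  have "path_edges ((x # B @ A) @ [x]) = path_edges ((A @ x # B) @ [a])"
    using path_edges_append[of "x # B" a "A' @ [x]"] path_edges_append[of A x "B @ [a]"] Cons by auto
  then show ?thesis using assms Cons by (auto simp: cyclic_def)
qed

lemma cyclic_subset: "cyclic vs \<Longrightarrow> set vs \<subseteq> verts G"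
  using set_subset_verts[of "vs @ [hd vs]"] by (auto simp: cyclic_def)

text \<open>2-connectedness gives an ear \<open>E\<close> through a vertex off the cycle, joining
  two cycle vertices \<open>x\<close> and \<open>y\<close>. By \<open>no_theta\<close> these are
  consecutive on the cycle, and the edge between them can be replaced by the ear.\<close>

lemma cyclic_extend:
  assumes "cyclic vs" "set vs \<noteq> verts G" "k_connected 2 G"
  shows "\<exists>ws. cyclic ws \<and> length ws > length vs"
proof -
  let ?C = "set vs"
  have conn: "connected_graph (delete_verts G X)" if "X \<subseteq> verts G" "card X < 2" for X
    using assms(3) that by (auto simp: k_connected_def)
  have vs: "distinct vs" "length vs \<ge> 2" using assms(1) by (auto simp: cyclic_def)
  then have ne: "vs \<noteq> []" by auto
  have CV: "?C \<subseteq> verts G" using cyclic_subset[OF assms(1)] .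
  then obtain w0 where w0: "w0 \<in> verts G" "w0 \<notin> ?C" using assms(2) by blast
  have "connected_graph (delete_verts G {})" using conn by simp
  then have "(w0, hd vs) \<in> {(x, y). {x, y} \<in> edges G}\<^sup>*"
    using w0(1) subsetD[OF CV hd_in_set[OF ne]] by (simp add: connected_graph_def delete_verts_def)
  from first_hit_path[OF this w0(2)] ne obtain us x where
    us: "set (w0 # us) \<inter> ?C = {}" "x \<in> ?C" "path_edges (w0 # us @ [x]) \<subseteq> edges G" by auto
  \<comment> \<open>Only the last edge of the path found is kept; it is the first edge of the
    ear.\<close>
  obtain w where w: "w \<notin> ?C" "{x, w} \<in> edges G"
  proof -
    let ?l = "last (w0 # us)"
    have l: "?l \<in> set (w0 # us)" by (rule last_in_set) simp
    have "{?l, x} \<in> edges G" using us(3) path_edges_snoc[of "w0 # us" x] by simp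
    then show ?thesis using that[of ?l] l us(1) by (auto simp: insert_commute)
  qed
  have xV: "x \<in> verts G" using us(2) CV by blast
  obtain A B where AB: "vs = A @ x # B" using us(2) by (meson split_list)
  define N where "N = B @ A"
  have cyc: "cyclic (x # N)" using cyclic_rotate assms(1) AB by (simp add: N_def)
  have setN: "?C = insert x (set N)" "length vs = length (x # N)" using AB by (auto simp: N_def)
  then obtain z where z: "z \<in> set N" using vs(2) by (cases N) auto
  have zx: "z \<noteq> x" using z cyc by (auto simp: cyclic_def)
  \<comment> \<open>Deleting \<open>x\<close> forces the ear to return to the cycle at another
    vertex.\<close>
  have "connected_graph (delete_verts G {x})" using conn xV by simp
  moreover have "w \<in> verts G" using w(2) edge(1) by blast
  moreover have "w \<noteq> x" using w(1) us(2) by auto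
  moreover have "z \<in> verts G" using z CV setN(1) by blast
  ultimately have "(w, z) \<in> {(a, b). {a, b} \<in> {f \<in> edges G. f \<inter> {x} = {}}}\<^sup>*"
    using zx by (auto simp: connected_graph_def delete_verts_def)
  from first_hit_path[OF this, of "?C"] w(1) z setN(1) obtain ws y where
    ws: "distinct (w # ws)" "set (w # ws) \<inter> ?C = {}" "y \<in> ?C"
      "path_edges (w # ws @ [y]) \<subseteq> {f \<in> edges G. f \<inter> {x} = {}}" by auto
  define E where "E = w # ws"
  have "y \<noteq> x"
  proof
    assume "y = x"
    then show False using ws(4) path_edges_snoc[of "w # ws" y] by auto
  qed
  then have "y \<in> set N" using ws(3) setN(1) by auto
  then obtain L M where LM: "N = L @ y # M" by (meson split_list)
  have ed: "path_edges (x # L @ [y]) \<subseteq> edges G" "path_edges (y # M @ [x]) \<subseteq> edges G"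
    using cyc path_edges_append[of "x # L" y "M @ [x]"] by (auto simp: cyclic_def LM)
  have ed': "path_edges (x # rev M @ [y]) \<subseteq> edges G"
    using ed(2) path_edges_rev[of "y # M @ [x]"] by simp
  have edE: "path_edges (x # E @ [y]) \<subseteq> edges G" using ws(4) w(2) by (auto simp: E_def)
  have dist: "distinct (x # L @ y # M)" "distinct E" "set E \<inter> insert x (set (L @ y # M)) = {}"
    using cyc ws(1,2) setN(1) by (auto simp: cyclic_def LM E_def)
  have "L = [] \<or> M = []"
  proof (rule ccontr)
    assume "\<not> ?thesis"
    then show False
      using dist ed(1) ed' edE
      by (intro no_theta[of x L y "rev M" E]) (auto simp: E_def)
  qed
  then show ?thesis
  proof
    assume "L = []"
    have "cyclic (x # E @ y # M)"
      using dist edE ed(2) path_edges_append[of "x # E" y "M @ [x]"]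
      by (auto simp: cyclic_def)
    then show ?thesis using setN(2) LM \<open>L = []\<close> by (intro exI[of _ "x # E @ y # M"]) (simp add: E_def)
  next
    assume "M = []"
    have "cyclic (x # L @ y # rev E)"
      using dist edE ed(1) path_edges_append[of "x # L" y "rev E @ [x]"] path_edges_rev[of "x # E @ [y]"]
      by (auto simp: cyclic_def)
    then show ?thesis using setN(2) LM \<open>M = []\<close> by (intro exI[of _ "x # L @ y # rev E"]) (simp add: E_def)
  qed
qed

text \<open>A single edge is cyclic and lengths are bounded by the number of vertices, so a longest
  cyclic list exists. It cannot be extended, hence it visits every vertex.\<close>

lemma hamiltonian:
  assumes "k_connected 2 G"
  shows "\<exists>vs. cyclic vs \<and> set vs = verts G"
proof -
  have V: "finite (verts G)" "card (verts G) > 2"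
    using simple assms by (auto simp: simple_graph_def k_connected_def)
  obtain a b where ab: "a \<in> verts G" "b \<in> verts G" "a \<noteq> b"
    using V card_le_Suc0_iff_eq[OF V(1)] by fastforce
  have "connected_graph (delete_verts G {})" using assms by (auto simp: k_connected_def)
  then have "(a, b) \<in> {(x, y). {x, y} \<in> edges G}\<^sup>*"
    using ab by (auto simp: connected_graph_def delete_verts_def)
  then obtain c where "{a, c} \<in> edges G" using ab(3) by (auto elim: converse_rtranclE)
  then have "cyclic [a, c]" using edge(2)[of "{a, c}"] by (auto simp: cyclic_def insert_commute card_insert_if split: if_splits)
  moreover have "length vs \<le> card (verts G)" if "cyclic vs" for vs
    using card_mono[OF V(1) cyclic_subset[OF that]] that by (simp add: cyclic_def distinct_card)
  ultimately obtain vs where "cyclic vs" "\<And>ws. cyclic ws \<Longrightarrow> length ws \<le> length vs"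
    using ex_has_greatest_nat[of cyclic "[a, c]" length "Suc (card (verts G))"]
    by (auto simp: less_Suc_eq_le)
  then show ?thesis using cyclic_extend[OF _ _ assms] by (meson not_le)
qed

text \<open>Splitting the list at the four positions and rotating it to start at position
  \<open>i\<close> gives the pattern of \<open>no_crossing_chords\<close>.\<close>

lemma cyclic_noncrossing:
  assumes "cyclic vs" "i < j" "j < k" "k < l" "l < length vs"
    and "{vs ! i, vs ! k} \<in> edges G" "{vs ! j, vs ! l} \<in> edges G"
  shows False
proof -
  have split: "\<exists>A B. drop a vs = A @ vs ! b # B \<and> B = drop (Suc b) vs" if "a \<le> b" "b < length vs" for a b
  proof -
    have "drop a vs = take (b - a) (drop a vs) @ drop b vs"
      using that append_take_drop_id[of "b - a" "drop a vs"] by simp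
    then show ?thesis using that by (metis Cons_nth_drop_Suc)
  qed
  obtain A where A: "vs = A @ vs ! i # drop (Suc i) vs" using split[of 0 i] assms by auto
  obtain B where B: "drop (Suc i) vs = B @ vs ! j # drop (Suc j) vs" using split[of "Suc i" j] assms by auto
  obtain C where C: "drop (Suc j) vs = C @ vs ! k # drop (Suc k) vs" using split[of "Suc j" k] assms by auto
  obtain D where D: "drop (Suc k) vs = D @ vs ! l # drop (Suc l) vs" using split[of "Suc k" l] assms by auto
  let ?F = "drop (Suc l) vs @ A"
  have "cyclic (vs ! i # drop (Suc i) vs @ A)" using cyclic_rotate[of A "vs ! i"] A assms(1) by simp
  then have "cyclic (vs ! i # B @ vs ! j # C @ vs ! k # D @ vs ! l # ?F)"
    unfolding B C D by simp
  then show False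
    using no_crossing_chords[of "vs ! i" B "vs ! j" C "vs ! k" D "vs ! l" ?F] assms(6,7)
    by (simp add: cyclic_def)
qed

end

section \<open>Colouring\<close>

lemma finite_edges: "simple_graph G \<Longrightarrow> finite (edges G)"
  by (rule finite_subset[of _ "Pow (verts G)"]) (auto simp: simple_graph_def)

lemma triangle_subset_edges: "T \<in> triangles G \<Longrightarrow> T \<subseteq> edges G"
  by (auto simp: triangles_def)

lemma finite_triangles: "simple_graph G \<Longrightarrow> finite (triangles G)"
  using triangle_subset_edges finite_edges by (metis PowI finite_Pow_iff finite_subset subsetI)

text \<open>Deleting an edge can only destroy triangles, so equal counts mean equal sets. A common
  neighbour would give a triangle through the deleted edge.\<close>

lemma new_edge_no_common_neighbour:
  assumes "simple_graph Q" "card (triangles (delete_edge Q {u, v})) = card (triangles Q)"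
    and "{u, v} \<in> edges Q" "{u, w} \<in> edges (delete_edge Q {u, v})" "{v, w} \<in> edges (delete_edge Q {u, v})"
  shows False
proof -
  have "triangles (delete_edge Q {u, v}) \<subseteq> triangles Q"
    unfolding triangles_def delete_edge_def snd_conv by blast
  then have eq: "triangles (delete_edge Q {u, v}) = triangles Q"
    using assms(2) finite_triangles[OF assms(1)] by (intro card_subset_eq)
  have "card {u, w} = 2" "card {v, w} = 2" "card {u, v} = 2"
    using assms(1,3-5) unfolding simple_graph_def delete_edge_def by auto
  then have "u \<noteq> v" "v \<noteq> w" "w \<noteq> u" by auto
  moreover have "{v, w} \<in> edges Q" "{w, u} \<in> edges Q"
    using assms(4,5) by (simp_all add: delete_edge_def insert_commute)
  ultimately have "{{u, v}, {v, w}, {w, u}} \<in> triangles Q"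
    unfolding triangles_def using assms(3) by blast
  then have "{{u, v}, {v, w}, {w, u}} \<in> triangles (delete_edge Q {u, v})" using eq by simp
  then have "{{u, v}, {v, w}, {w, u}} \<subseteq> edges (delete_edge Q {u, v})"
    by (rule triangle_subset_edges)
  then show False by (simp add: delete_edge_def)
qed

text \<open>An increasing triple of positions is recovered from its triangle: the union of the three
  edges gives the vertex set, hence the set of positions, and their order is forced.\<close>

lemma card_ordered_triangles_le:
  assumes "simple_graph G" "distinct vs"
    and "R = {(i, j). i < length vs \<and> j < length vs \<and> {vs ! i, vs ! j} \<in> edges G}"
  shows "card (ordered_triangles R) \<le> card (triangles G)"
proof (rule card_inj_on_le[OF _ _ finite_triangles[OF assms(1)]])
  let ?t = "\<lambda>(i, j, k). {{vs ! i, vs ! j}, {vs ! j, vs ! k}, {vs ! k, vs ! i}}"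
  have D: "i < j \<and> j < k \<and> k < length vs \<and> {vs ! i, vs ! j} \<in> edges G \<and>
      {vs ! j, vs ! k} \<in> edges G \<and> {vs ! k, vs ! i} \<in> edges G"
    if "(i, j, k) \<in> ordered_triangles R" for i j k
    using that by (auto simp: ordered_triangles_def assms(3) insert_commute)
  show "?t ` ordered_triangles R \<subseteq> triangles G"
  proof
    fix T assume "T \<in> ?t ` ordered_triangles R"
    then obtain i j k where ijk: "(i, j, k) \<in> ordered_triangles R" "T = ?t (i, j, k)" by auto
    then have "vs ! i \<noteq> vs ! j" "vs ! j \<noteq> vs ! k" "vs ! k \<noteq> vs ! i"
      using D[OF ijk(1)] assms(2) by (auto simp: nth_eq_iff_index_eq)
    then show "T \<in> triangles G" using D[OF ijk(1)] ijk(2) unfolding triangles_def by auto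
  qed
  show "inj_on ?t (ordered_triangles R)"
  proof (rule inj_onI)
    fix s t assume st: "s \<in> ordered_triangles R" "t \<in> ordered_triangles R" "?t s = ?t t"
    obtain i j k i' j' k' where s: "s = (i, j, k)" "t = (i', j', k')" by (cases s, cases t) auto
    note d = D[OF st(1)[unfolded s]] D[OF st(2)[unfolded s]]
    have "\<Union> (?t s) = \<Union> (?t t)" using st(3) by simp
    then have "(!) vs ` {i, j, k} = (!) vs ` {i', j', k'}" by (simp add: s insert_commute)
    moreover have "inj_on ((!) vs) {..<length vs}"
      using assms(2) by (auto simp: inj_on_def nth_eq_iff_index_eq)
    ultimately have eq: "{i, j, k} = {i', j', k'}"
      using d by (subst (asm) inj_on_image_eq_iff[of _ "{..<length vs}"]) auto
    have "i = i' \<or> i = j' \<or> i = k'" "i' = i \<or> i' = j \<or> i' = k" "j = i' \<or> j = j' \<or> j = k'"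
      "k = i' \<or> k = j' \<or> k = k'" "k' = i \<or> k' = j \<or> k' = k"
      using eq by blast+
    then have "i = i' \<and> j = j' \<and> k = k'" using d by linarith
    then show "s = t" using s by simp
  qed
qed

theorem theorem3p4:
  fixes G Q :: "'a graph"
    and p :: "'a \<Rightarrow> complex"
    and \<gamma> :: "'a set \<Rightarrow> real \<Rightarrow> complex"
    and e :: "'a set"
  assumes "simple_graph G"
    and "outerplane G p \<gamma>"
    and "k_connected 2 G"
    and "card (triangles G) = 2"
    and "simple_graph Q"
    and "card (triangles Q) = 2"
    and "e \<in> edges Q"
    and "G = delete_edge Q e"
  shows "colorable 3 Q"
proof -
  interpret outerplane_graph G p \<gamma> using assms(1,2) by unfold_locales
  obtain vs where vs: "cyclic vs" "set vs = verts G" using hamiltonian[OF assms(3)] by blast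
  have dist: "distinct vs" using vs(1) by (simp add: cyclic_def)
  have VQ: "verts Q = set vs" "edges Q = insert e (edges G)"
    using vs(2) assms(7,8) by (auto simp: delete_edge_def)
  \<comment> \<open>The positions on the Hamiltonian cycle serve as the linear order, which turns
    \<open>G\<close> into a noncrossing graph on \<open>{..<length vs}\<close>.\<close>
  define R where "R = {(i, j). i < length vs \<and> j < length vs \<and> {vs ! i, vs ! j} \<in> edges G}"
  have "e \<subseteq> set vs" "card e = 2" using assms(5,7) VQ(1) by (auto simp: simple_graph_def)
  then obtain a b where ab: "e = {a, b}" "a \<noteq> b" "a \<in> set vs" "b \<in> set vs"
    by (auto simp: card_2_iff)
  then obtain u v where uv: "u < length vs" "v < length vs" "vs ! u = a" "vs ! v = b"
    by (auto simp: in_set_conv_nth)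
  have "\<exists>c. proper3 R c \<and> c u \<noteq> c v"
  proof (rule noncrossing_separating_colouring[of "{..<length vs}"])
    show "R \<subseteq> {..<length vs} \<times> {..<length vs}" "sym R"
      by (auto simp: R_def sym_def insert_commute)
    show "irrefl R" using edge(2) by (fastforce simp: irrefl_def R_def)
    show "noncrossing R"
      using cyclic_noncrossing[OF vs(1)] by (auto simp: noncrossing_def R_def)
    show "(u, v) \<notin> R" using ab(1) uv assms(8) by (auto simp: R_def delete_edge_def)
    show "(v, w) \<notin> R" if "(u, w) \<in> R" for w
      using new_edge_no_common_neighbour[of Q a b "vs ! w"] that ab(1) uv assms(4-8)
      by (auto simp: R_def)
    show "card (ordered_triangles R) \<le> 2"
      using card_ordered_triangles_le[OF assms(1) dist R_def] assms(4) by simp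
  qed (use uv ab(2) in auto)
  then obtain c where c: "proper3 R c" "c u \<noteq> c v" by blast
  \<comment> \<open>\<open>idx\<close> carries the colouring of positions back to vertices.\<close>
  define idx where "idx = the_inv_into {..<length vs} ((!) vs)"
  have injn: "inj_on ((!) vs) {..<length vs}"
    using dist by (auto simp: inj_on_def nth_eq_iff_index_eq)
  have idx: "idx (vs ! i) = i" if "i < length vs" for i
    unfolding idx_def using that by (intro the_inv_into_f_f[OF injn]) simp
  have proper: "c (idx x) \<noteq> c (idx y)" if xy: "{x, y} \<in> edges G" for x y
  proof -
    have "x \<in> set vs" "y \<in> set vs" using edge(1)[OF xy] vs(2) by auto
    then obtain i j where "i < length vs" "j < length vs" "vs ! i = x" "vs ! j = y"
      by (auto simp: in_set_conv_nth)
    then show ?thesis using c(1) idx xy by (auto simp: proper3_def R_def)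
  qed
  show ?thesis
    unfolding colorable_def
  proof (intro exI conjI allI impI)
    show "(c \<circ> idx) ` verts Q \<subseteq> {1..3}" using c(1) unfolding proper3_def by auto
    fix x y assume "{x, y} \<in> edges Q"
    then consider "{x, y} \<in> edges G" | "x = a" "y = b" | "x = b" "y = a"
      using VQ(2) ab(1) by (auto simp: doubleton_eq_iff)
    then show "(c \<circ> idx) x \<noteq> (c \<circ> idx) y"
    proof cases
      case 1 then show ?thesis using proper by simp
    next
      case 2 then show ?thesis using c(2) idx[OF uv(1)] idx[OF uv(2)] uv(3,4) by simp
    next
      case 3 then show ?thesis using c(2) idx[OF uv(1)] idx[OF uv(2)] uv(3,4) by simp
    qed
  qed
qed

end
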